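(* Let $\mathcal{G}=(\mathcal{V},\mathcal{E})$ be a digraph on $n>1$ nodes, and fix activation probabilities $p_{ij}$ and updating weights $w_{ij}$ as in the context. Then $\mathcal{G}$ is strongly connected if and only if there exists $\bar\epsilon>0$ such that for every $\epsilon\in(0,\bar\epsilon)$ the gossip algorithm with parameter $\epsilon$ achieves mean-square average consensus.
   Context: Setting: $\mathcal{V}=\{1,\dots,n\}$, $n>1$, and $\mathcal{G}$ has no selfloops. An edge $(j,i)$ means that $j$ sends to $i$. To each edge $(j,i)\in\mathcal{E}$ are assigned a probability $p_{ij}\in(0,1)$, with $\sum_{(j,i)\in\mathcal{E}}p_{ij}=1$, and an updating weight $w_{ij}\in(0,1)$. Gossip algorithm with parameter $\epsilon>0$: at each time $k\in\mathbb{Z}_+$, exactly one edge is activated. The choice is independent of the past, and edge $(j,i)$ is activated with probability $p_{ij}$. If $(j,i)$ is activated, then $$x_i(k+1)=x_i(k)+w_{ij}(x_j(k)-x_i(k))+\epsilon w_{ij}s_i(k),\qquad s_i(k+1)=s_i(k)+s_j(k)-(x_i(k+1)-x_i(k)),$$ $$x_j(k+1)=x_j(k),\qquad s_j(k+1)=0,$$ and $x_l(k+1)=x_l(k)$, $s_l(k+1)=s_l(k)$ for every other node $l$. The initial condition is $s(0)=0$ with $x(0)\in\mathbb{R}^n$ arbitrary (deterministic). Mean-square average consensus: for every $x(0)$, $E[\|x(k)-x_a\mathbf{1}\|_2^2]\to0$ and $E[\|s(k)\|_2^2]\to0$ as $k\to\infty$, where $x_a=\mathbf{1}^Tx(0)/n$.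 *)

theory Defs
  imports Complex_Main
begin

text \<open>Nodes are 1..n. An edge (j,i) in E means j sends to i. p i j and w i j are
  the activation probability and updating weight of edge (j,i).
  Network state: pair (x, s) of functions nat => real (only values on 1..n matter).\<close>

definition strongly_connected :: "nat \<Rightarrow> (nat \<times> nat) set \<Rightarrow> bool" where
  "strongly_connected n E \<longleftrightarrow> (\<forall>u\<in>{1..n}. \<forall>v\<in>{1..n}. (u, v) \<in> E\<^sup>*)"

text \<open>One step of the gossip algorithm when edge (j,i) is activated.\<close>
definition gossip_step ::
  "real \<Rightarrow> (nat \<Rightarrow> nat \<Rightarrow> real) \<Rightarrow> nat \<times> nat \<Rightarrow>
   (nat \<Rightarrow> real) \<times> (nat \<Rightarrow> real) \<Rightarrow> (nat \<Rightarrow> real) \<times> (nat \<Rightarrow> real)" where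
  "gossip_step eps w e st =
     (case e of (j, i) \<Rightarrow> case st of (x, s) \<Rightarrow>
       (let xi' = x i + w i j * (x j - x i) + eps * w i j * s i
        in (x(i := xi'), s(i := s i + s j - (xi' - x i), j := 0))))"

text \<open>State after activating the edges of the list in order (head = time 0).\<close>
definition gossip_run ::
  "real \<Rightarrow> (nat \<Rightarrow> nat \<Rightarrow> real) \<Rightarrow> (nat \<times> nat) list \<Rightarrow>
   (nat \<Rightarrow> real) \<times> (nat \<Rightarrow> real) \<Rightarrow> (nat \<Rightarrow> real) \<times> (nat \<Rightarrow> real)" where
  "gossip_run eps w es st = foldl (\<lambda>st' e. gossip_step eps w e st') st es"

text \<open>Expectation at time k of a function of the state: the activations at times
  0..k-1 are i.i.d., edge (j,i) having probability p i j, so the law of the first k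
  activated edges is the product distribution on sequences of edges of length k.\<close>
definition gossip_expect ::
  "(nat \<times> nat) set \<Rightarrow> (nat \<Rightarrow> nat \<Rightarrow> real) \<Rightarrow> (nat \<Rightarrow> nat \<Rightarrow> real) \<Rightarrow> real \<Rightarrow>
   (nat \<Rightarrow> real) \<Rightarrow> nat \<Rightarrow> ((nat \<Rightarrow> real) \<times> (nat \<Rightarrow> real) \<Rightarrow> real) \<Rightarrow> real" where
  "gossip_expect E p w eps x0 k f =
     (\<Sum>es\<in>{es. set es \<subseteq> E \<and> length es = k}.
        (\<Prod>e\<leftarrow>es. p (snd e) (fst e)) * f (gossip_run eps w es (x0, (\<lambda>_. 0))))"

text \<open>Mean-square average consensus (initial condition s(0)=0, x(0) arbitrary).\<close>
definition ms_average_consensus ::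
  "nat \<Rightarrow> (nat \<times> nat) set \<Rightarrow> (nat \<Rightarrow> nat \<Rightarrow> real) \<Rightarrow> (nat \<Rightarrow> nat \<Rightarrow> real) \<Rightarrow> real \<Rightarrow> bool" where
  "ms_average_consensus n E p w eps \<longleftrightarrow>
     (\<forall>x0 :: nat \<Rightarrow> real.
        let xa = (\<Sum>l\<in>{1..n}. x0 l) / real n in
        (\<lambda>k. gossip_expect E p w eps x0 k (\<lambda>(x, s). \<Sum>l\<in>{1..n}. (x l - xa)\<^sup>2)) \<longlonglongrightarrow> 0 \<and>
        (\<lambda>k. gossip_expect E p w eps x0 k (\<lambda>(x, s). \<Sum>l\<in>{1..n}. (s l)\<^sup>2)) \<longlonglongrightarrow> 0)"

end

theory Submission
  imports Defs "Jordan_Normal_Form.Determinant"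
begin

text \<open>
  If the graph is not strongly connected, some set of nodes never hears from its complement, so it
  keeps the value 0 when the initial state is the indicator of that complement.

  For the converse, shift so that the conserved quantity \<Sum>x + \<Sum>s vanishes. For \<epsilon> = 0 the
  values x perform plain gossip: with the stationary weights \<pi> of the mean dynamics, \<Sum>\<pi>x^2 loses
  exactly a Dirichlet form in each step, which controls the disagreement. The surplus s is carried by
  coalescing random walks; once they have met, it is a single lump of size \<Sum>s \<approx> -nm, where
  m = \<Sum>\<pi>x. To first order in \<epsilon> the drift of m^2 is 2\<epsilon>m times a linear functional q of s, and a
  corrector g (truncated solution of the Poisson equation for the walk) replaces q(s) by a positive
  multiple of \<Sum>s \<approx> -nm, giving a negative drift of order \<epsilon>m^2. Hence
  \<Sum>\<pi>x^2 + \<epsilon>(2m g(s) + \<zeta> R(s)), where R(s) sums the expected square norms of s over K steps of pure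
  merging, is a quadratic Lyapunov function that contracts geometrically for small \<epsilon>.
\<close>

text \<open>At \<epsilon> = 0 nothing forces contraction, even on the hyperplane of vanishing total:
  x constant equal to m together with a wandering lump of surplus -nm persists forever. The decay
  has to be extracted from the terms of order \<epsilon>, where x and s interact and have arbitrary
  signs. The scales are as follows. The disagreement D loses D^2 at order one, while m^2 and the
  squared size A^2 of the surplus lose only at order \<epsilon>. An error \<epsilon>D(|m| + A) is
  harmless, since it costs a share of D^2 and terms of order \<epsilon>^2. The dangerous terms are
  those of order \<epsilon> without a factor D. The product m q(s) is replaced by means of the
  corrector g; the error \<tau>|m|A of this replacement is small because K is large; the return of
  (\<Sum>s)^2 in the drift of R is held below the decay of m^2 by a small \<zeta>.\<close>

text \<open>A square matrix and its transpose have the same determinant. This produces a stationary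
  vector of the mean dynamics from the constant right kernel vector; its sign remains to be
  settled.\<close>

lemma left_kernel_of_right_kernel:
  fixes L :: "nat \<Rightarrow> nat \<Rightarrow> real"
  assumes f: "k \<in> {1..n}" "f k \<noteq> 0" and ker: "\<And>i. i \<in> {1..n} \<Longrightarrow> (\<Sum>j\<in>{1..n}. L i j * f j) = 0"
  obtains v k' where "k' \<in> {1..n}" "v k' \<noteq> 0" "\<And>j. j \<in> {1..n} \<Longrightarrow> (\<Sum>i\<in>{1..n}. v i * L i j) = 0"
proof -
  have shift: "(\<Sum>j\<in>{1..n}. h j) = (\<Sum>j = 0..<n. h (Suc j))" for h :: "nat \<Rightarrow> real"
    by (simp add: sum.atLeast1_atMost_eq lessThan_atLeast0)
  define A where "A = mat n n (\<lambda>(i, j). L (Suc i) (Suc j))"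
  have A: "A \<in> carrier_mat n n" by (simp add: A_def)
  define u where "u = vec n (\<lambda>i. f (Suc i))"
  have "u \<in> carrier_vec n" by (simp add: u_def)
  moreover have "u $ (k - 1) \<noteq> 0" using f by (auto simp: u_def)
  hence "u \<noteq> 0\<^sub>v n" using f by auto
  moreover have "A *\<^sub>v u = 0\<^sub>v n"
  proof (rule eq_vecI)
    fix i assume "i < dim_vec (0\<^sub>v n :: real vec)"
    hence i: "i < n" by simp
    have "(\<Sum>j = 0..<n. L (Suc i) (Suc j) * f (Suc j)) = 0" using ker[of "Suc i"] i by (simp only: shift) auto
    thus "(A *\<^sub>v u) $ i = 0\<^sub>v n $ i" using i by (simp add: A_def u_def scalar_prod_def)
  qed (simp add: A_def)
  ultimately have "det A = 0" using det_0_iff_vec_prod_zero[OF A] by blast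
  hence "det (transpose_mat A) = 0" using det_transpose[OF A] by simp
  then obtain v where v: "v \<in> carrier_vec n" "v \<noteq> 0\<^sub>v n" "transpose_mat A *\<^sub>v v = 0\<^sub>v n"
    using det_0_iff_vec_prod_zero[of "transpose_mat A" n] A by auto
  obtain i where i: "i < n" "v $ i \<noteq> 0" using v(1,2) by (metis carrier_vecD eq_vecI index_zero_vec(1) index_zero_vec(2))
  show thesis
  proof (rule that[of "Suc i" "\<lambda>i. v $ (i - 1)"])
    fix j assume j: "j \<in> {1..n}"
    have "(transpose_mat A *\<^sub>v v) $ (j - 1) = 0" using v(3) j by auto
    thus "(\<Sum>i\<in>{1..n}. v $ (i - 1) * L i j) = 0" using j v(1)
      by (simp only: shift) (auto simp: A_def scalar_prod_def mult.commute)
  qed (use i in auto)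
qed

section \<open>Expectations and necessity\<close>

locale gossip_network =
  fixes n :: nat and E :: "(nat \<times> nat) set" and p w :: "nat \<Rightarrow> nat \<Rightarrow> real"
  assumes n_gt_1: "n > 1"
    and edges: "E \<subseteq> {1..n} \<times> {1..n}"
    and no_loops: "\<forall>(j, i)\<in>E. j \<noteq> i"
    and prob: "\<forall>(j, i)\<in>E. 0 < p i j \<and> p i j < 1"
    and prob_sum: "(\<Sum>(j, i)\<in>E. p i j) = 1"
    and weight: "\<forall>(j, i)\<in>E. 0 < w i j \<and> w i j < 1"
begin

abbreviation pr :: "nat \<times> nat \<Rightarrow> real" where "pr e \<equiv> p (snd e) (fst e)"
abbreviation wt :: "nat \<times> nat \<Rightarrow> real" where "wt e \<equiv> w (snd e) (fst e)"
abbreviation V :: "nat set" where "V \<equiv> {1..n}"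

lemma finite_E [simp]: "finite E"
  using edges by (rule finite_subset) simp

lemma edge_facts:
  assumes "e \<in> E"
  shows "fst e \<in> V" "snd e \<in> V" "fst e \<noteq> snd e" "0 < pr e" "0 < wt e" "wt e < 1"
  using assms edges no_loops prob weight by auto

lemma pr_sum: "(\<Sum>e\<in>E. pr e) = 1"
  using prob_sum by (simp add: case_prod_beta)

lemma avg_mono:
  assumes "\<And>e. e \<in> E \<Longrightarrow> F e \<le> G e"
  shows "(\<Sum>e\<in>E. pr e * F e) \<le> (\<Sum>e\<in>E. pr e * G e)"
  by (intro sum_mono mult_left_mono assms) (auto dest: edge_facts(4) intro: less_imp_le)

lemma avg_const: "(\<Sum>e\<in>E. pr e * c) = c"
  by (simp add: sum_distrib_right[symmetric] pr_sum)

text \<open>The initial state is a parameter because the state after one step generally has nonzero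
  surplus; only so can one condition on the first activated edge and induct on
  \<open>k\<close>.\<close>

definition expect_from where
  "expect_from eps k f st =
     (\<Sum>es\<in>{es. set es \<subseteq> E \<and> length es = k}. (\<Prod>e\<leftarrow>es. pr e) * f (gossip_run eps w es st))"

lemma expect_from_0 [simp]: "expect_from eps 0 f st = f st"
proof -
  have "{es. set es \<subseteq> E \<and> length es = 0} = {[]}" by auto
  thus ?thesis by (simp add: expect_from_def gossip_run_def)
qed

lemma expect_from_Suc:
  "expect_from eps (Suc k) f st = (\<Sum>e\<in>E. pr e * expect_from eps k f (gossip_step eps w e st))"
proof -
  let ?L = "\<lambda>k. {es. set es \<subseteq> E \<and> length es = k}"
  have L: "?L (Suc k) = (\<lambda>(e, es). e # es) ` (E \<times> ?L k)"
    by (auto simp: image_iff length_Suc_conv)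
  have inj: "inj_on (\<lambda>(e, es). e # es) (E \<times> ?L k)" by (auto simp: inj_on_def)
  have "expect_from eps (Suc k) f st =
    (\<Sum>(e, es)\<in>E \<times> ?L k. pr e * ((\<Prod>e\<leftarrow>es. pr e) * f (gossip_run eps w es (gossip_step eps w e st))))"
    unfolding expect_from_def L sum.reindex[OF inj]
    by (auto intro!: sum.cong simp: gossip_run_def mult.assoc)
  also have "\<dots> = (\<Sum>e\<in>E. pr e * expect_from eps k f (gossip_step eps w e st))"
    by (simp add: sum.cartesian_product[symmetric] expect_from_def sum_distrib_left)
  finally show ?thesis .
qed

lemma expect_from_mono:
  assumes "\<And>es. set es \<subseteq> E \<Longrightarrow> length es = k \<Longrightarrow> f (gossip_run eps w es st) \<le> f' (gossip_run eps w es st)"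
  shows "expect_from eps k f st \<le> expect_from eps k f' st"
  unfolding expect_from_def
  by (intro sum_mono mult_left_mono assms prod_list_nonneg)
     (auto dest!: subsetD edge_facts(4) intro: less_imp_le)

lemma expect_from_const: "expect_from eps k (\<lambda>_. c) st = c"
  by (induction k arbitrary: st) (simp_all add: expect_from_Suc avg_const)

lemma expect_from_cmult: "expect_from eps k (\<lambda>y. c * f y) st = c * expect_from eps k f st"
  by (simp add: expect_from_def sum_distrib_left mult_ac)

lemma gossip_expect_eq: "gossip_expect E p w eps x0 k f = expect_from eps k f (x0, \<lambda>_. 0)"
  by (simp add: gossip_expect_def expect_from_def)

lemma run_invariant:
  assumes "set es \<subseteq> E" "I st" "\<And>e st. e \<in> E \<Longrightarrow> I st \<Longrightarrow> I (gossip_step eps w e st)"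
  shows "I (gossip_run eps w es st)"
  using assms(1,2) by (induction es arbitrary: st) (auto simp: gossip_run_def assms(3))

text \<open>Iterates a one-step contraction. It is relative to an invariant \<open>I\<close> because
  the drift of the Lyapunov function is established only where the sum of all x and s
  vanishes.\<close>

lemma expect_from_geometric:
  assumes "I st" "\<And>e st. e \<in> E \<Longrightarrow> I st \<Longrightarrow> I (gossip_step eps w e st)" "\<rho> \<ge> 0"
    and drift: "\<And>st. I st \<Longrightarrow> (\<Sum>e\<in>E. pr e * W (gossip_step eps w e st)) \<le> \<rho> * W st"
  shows "expect_from eps k W st \<le> \<rho> ^ k * W st"
  using assms(1)
proof (induction k arbitrary: st)
  case (Suc k)
  have "expect_from eps (Suc k) W st \<le> (\<Sum>e\<in>E. pr e * (\<rho> ^ k * W (gossip_step eps w e st)))"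
    unfolding expect_from_Suc by (intro avg_mono Suc.IH assms(2) Suc.prems)
  also have "\<dots> = \<rho> ^ k * (\<Sum>e\<in>E. pr e * W (gossip_step eps w e st))"
    by (simp add: sum_distrib_left mult_ac)
  also have "\<dots> \<le> \<rho> ^ k * (\<rho> * W st)"
    using drift[OF Suc.prems] \<open>\<rho> \<ge> 0\<close> by (intro mult_left_mono) auto
  finally show ?case by (simp add: mult_ac)
qed simp

text \<open>With the increment \<delta> explicit, what x gains at the head is what s loses there:
  the conservation law. The surplus inside \<delta> is the one before merging.\<close>

lemma gossip_step_alt:
  "gossip_step eps w e (x, s) =
    (let \<delta> = wt e * (x (fst e) - x (snd e)) + eps * wt e * s (snd e)
     in (x(snd e := x (snd e) + \<delta>), s(snd e := s (snd e) + s (fst e) - \<delta>, fst e := 0)))"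
  by (cases e) (simp add: gossip_step_def Let_def algebra_simps)

section \<open>Necessity: a set of nodes that receives nothing from outside\<close>

lemma consensus_imp_strongly_connected:
  assumes "ms_average_consensus n E p w eps"
  shows "strongly_connected n E"
proof (rule ccontr)
  assume "\<not> strongly_connected n E"
  then obtain u v where uv: "u \<in> V" "v \<in> V" "(u, v) \<notin> E\<^sup>*"
    by (auto simp: strongly_connected_def)
  define x0 :: "nat \<Rightarrow> real" where "x0 l = (if (u, l) \<in> E\<^sup>* then 1 else 0)" for l
  define xa where "xa = (\<Sum>l\<in>V. x0 l) / real n"
  define I :: "(nat \<Rightarrow> real) \<times> (nat \<Rightarrow> real) \<Rightarrow> bool"
    where "I st \<longleftrightarrow> (\<forall>l. (u, l) \<notin> E\<^sup>* \<longrightarrow> fst st l = 0 \<and> snd st l = 0)" for st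
  have step: "I (gossip_step eps w e st)" if "e \<in> E" "I st" for e st
  proof -
    have "(u, fst e) \<notin> E\<^sup>*" if "(u, snd e) \<notin> E\<^sup>*"
      using that \<open>e \<in> E\<close> by (metis prod.collapse rtrancl.rtrancl_into_rtrancl)
    thus ?thesis using \<open>I st\<close>
      by (cases st) (auto simp: gossip_step_alt I_def Let_def)
  qed
  \<comment> \<open>The average is positive because \<open>u\<close> itself has value 1, while
    \<open>v\<close> stays at 0. Hence the error is at least \<open>xa\<^sup>2\<close> on every
    sample path.\<close>
  have "(\<Sum>l\<in>V. x0 l) \<ge> x0 u" using uv by (intro member_le_sum) (auto simp: x0_def)
  hence "xa > 0" using n_gt_1 by (auto simp: xa_def x0_def)
  define F :: "(nat \<Rightarrow> real) \<times> (nat \<Rightarrow> real) \<Rightarrow> real" where "F = (\<lambda>(x, s). \<Sum>l\<in>V. (x l - xa)\<^sup>2)"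
  have "xa\<^sup>2 \<le> gossip_expect E p w eps x0 k F" for k
  proof -
    have "expect_from eps k (\<lambda>_. xa\<^sup>2) (x0, \<lambda>_. 0) \<le> expect_from eps k F (x0, \<lambda>_. 0)"
    proof (rule expect_from_mono)
      fix es assume "set es \<subseteq> E"
      moreover have "I (x0, \<lambda>_. 0)" by (simp add: I_def x0_def)
      ultimately have "I (gossip_run eps w es (x0, \<lambda>_. 0))" using step by (intro run_invariant[where I = I])
      moreover obtain x s where xs: "gossip_run eps w es (x0, \<lambda>_. 0) = (x, s)" by force
      ultimately have "x v = 0" using uv by (simp add: I_def)
      moreover have "(x v - xa)\<^sup>2 \<le> (\<Sum>l\<in>V. (x l - xa)\<^sup>2)" using uv by (intro member_le_sum) auto
      ultimately show "xa\<^sup>2 \<le> F (gossip_run eps w es (x0, \<lambda>_. 0))" by (simp add: xs F_def)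
    qed
    thus ?thesis by (simp add: expect_from_const gossip_expect_eq)
  qed
  moreover have "(\<lambda>k. gossip_expect E p w eps x0 k F) \<longlonglongrightarrow> 0"
    using assms by (simp add: ms_average_consensus_def Let_def xa_def F_def)
  ultimately have "xa\<^sup>2 \<le> 0" by (intro LIMSEQ_le_const[where X = "\<lambda>k. gossip_expect E p w eps x0 k F"]) auto
  with \<open>xa > 0\<close> show False by simp
qed

section \<open>Stationary weights and coalescing walks\<close>

text \<open>The weights form the invariant law of the walk that jumps from the head of
  \<open>e\<close> to its tail at rate \<open>c e\<close>. Stationarity is tested against all
  functions so that it can be used for squares of x. A sign argument takes the place of
  Perron-Frobenius.\<close>

lemma stationary_vector:
  fixes c :: "nat \<times> nat \<Rightarrow> real"
  assumes sc: "strongly_connected n E" and c: "\<And>e. e \<in> E \<Longrightarrow> c e > 0"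
  obtains \<pi> where "\<And>i. i \<in> V \<Longrightarrow> \<pi> i > 0" "(\<Sum>i\<in>V. \<pi> i) = 1"
    "\<And>f. (\<Sum>e\<in>E. \<pi> (snd e) * c e * (f (fst e) - f (snd e))) = 0"
proof -
  \<comment> \<open>The generator as a matrix: row \<open>i\<close> applied to \<open>f\<close> sums
    \<open>c e * (f (fst e) - f (snd e))\<close> over the edges with head \<open>i\<close>.
    Constants lie in its kernel.\<close>
  define L where "L i j = (\<Sum>e\<in>E. c e * (of_bool (snd e = i) * (of_bool (fst e = j) - of_bool (snd e = j))))"
    for i j
  have pick: "(\<Sum>l\<in>V. h l * of_bool (a = l)) = h a" if "a \<in> V" for h :: "nat \<Rightarrow> real" and a
    using that by simp
  have "(\<Sum>j\<in>V. L i j * 1) = 0" for i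
  proof -
    have "(\<Sum>j\<in>V. L i j) =
        (\<Sum>e\<in>E. \<Sum>j\<in>V. c e * (of_bool (snd e = i) * (of_bool (fst e = j) - of_bool (snd e = j))))"
      unfolding L_def by (rule sum.swap)
    also have "\<dots> = (\<Sum>e\<in>E. 0)"
    proof (rule sum.cong[OF refl])
      fix e assume e: "e \<in> E"
      have "(\<Sum>j\<in>V. of_bool (fst e = j) - of_bool (snd e = j) :: real) = 0"
        using pick[OF edge_facts(1)[OF e], of "\<lambda>_. 1"] pick[OF edge_facts(2)[OF e], of "\<lambda>_. 1"]
        by (simp only: sum_subtractf mult_1_left)
      thus "(\<Sum>j\<in>V. c e * (of_bool (snd e = i) * (of_bool (fst e = j) - of_bool (snd e = j)))) = 0"
        by (simp only: sum_distrib_left[symmetric] mult_zero_right)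
    qed
    finally show ?thesis by simp
  qed
  note ker = this
  have "1 \<in> V" using n_gt_1 by simp
  obtain v k where k: "k \<in> V" "v k \<noteq> 0" and v: "\<And>j. j \<in> V \<Longrightarrow> (\<Sum>i\<in>V. v i * L i j) = 0"
    using left_kernel_of_right_kernel[of 1 n "\<lambda>_. 1" L, OF \<open>1 \<in> V\<close> one_neq_zero ker] by blast
  have v0: "(\<Sum>e\<in>E. v (snd e) * c e * (f (fst e) - f (snd e))) = 0" for f
  proof -
    have "0 = (\<Sum>j\<in>V. (\<Sum>i\<in>V. v i * L i j) * f j)" using v by simp
    also have "\<dots> = (\<Sum>j\<in>V. \<Sum>i\<in>V. \<Sum>e\<in>E. v i * of_bool (snd e = i) *
        (c e * (f j * of_bool (fst e = j) - f j * of_bool (snd e = j))))"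
      unfolding L_def sum_distrib_left sum_distrib_right
      by (intro sum.cong refl) (simp add: algebra_simps)
    also have "\<dots> = (\<Sum>j\<in>V. \<Sum>e\<in>E. \<Sum>i\<in>V. v i * of_bool (snd e = i) *
        (c e * (f j * of_bool (fst e = j) - f j * of_bool (snd e = j))))"
      by (intro sum.cong refl sum.swap)
    also have "\<dots> = (\<Sum>e\<in>E. \<Sum>j\<in>V. \<Sum>i\<in>V. v i * of_bool (snd e = i) *
        (c e * (f j * of_bool (fst e = j) - f j * of_bool (snd e = j))))"
      by (rule sum.swap)
    also have "\<dots> = (\<Sum>e\<in>E. v (snd e) * c e * (f (fst e) - f (snd e)))"
    proof (rule sum.cong[OF refl])
      fix e assume e: "e \<in> E"
      show "(\<Sum>j\<in>V. \<Sum>i\<in>V. v i * of_bool (snd e = i) *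
        (c e * (f j * of_bool (fst e = j) - f j * of_bool (snd e = j)))) = v (snd e) * c e * (f (fst e) - f (snd e))"
        unfolding sum_distrib_right[symmetric] pick[OF edge_facts(2)[OF e]]
          sum_distrib_left[symmetric] sum_subtractf pick[OF edge_facts(1)[OF e]] by simp
    qed
    finally show ?thesis by simp
  qed
  \<comment> \<open>Testing against the indicator of the positive set of u shows that this set is closed under in-neighbours.\<close>
  have pos: "\<forall>i\<in>V. u i > 0"
    if u0: "\<And>f. (\<Sum>e\<in>E. u (snd e) * c e * (f (fst e) - f (snd e))) = 0" and uk: "u k > 0"
    for u :: "nat \<Rightarrow> real"
  proof
    fix i assume i: "i \<in> V"
    have closed: "u (fst e) > 0" if e: "e \<in> E" "u (snd e) > 0" for e
    proof (rule ccontr)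
      assume neg: "\<not> u (fst e) > 0"
      define t where "t e' = u (snd e') * c e' * (of_bool (u (fst e') > 0) - of_bool (u (snd e') > 0))" for e'
      \<comment> \<open>A positive head makes the bracket at most 0, a nonpositive head makes it at
        least 0; the product is nonpositive either way.\<close>
      have le: "t e' \<le> 0" if "e' \<in> E" for e'
        using c[OF that] by (auto simp: t_def mult_le_0_iff)
      have "t e < 0" using neg e c[of e] by (simp add: t_def)
      hence "(\<Sum>e'\<in>E. t e') < (\<Sum>e'\<in>E. 0)" using le e(1) by (intro sum_strict_mono_ex1) auto
      moreover have "(\<Sum>e'\<in>E. t e') = 0" unfolding t_def by (rule u0)
      ultimately show False by simp
    qed
    have "(i, k) \<in> E\<^sup>*" using sc i k by (simp add: strongly_connected_def)
    thus "u i > 0"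
      by (induction rule: converse_rtrancl_induct) (use uk closed in auto)
  qed
  \<comment> \<open>The vector \<open>v\<close> is only known to be nonzero at \<open>k\<close>; the
    equation is linear, so its sign can be flipped.\<close>
  have "\<exists>u. (\<forall>i\<in>V. u i > 0) \<and> (\<forall>f. (\<Sum>e\<in>E. u (snd e) * c e * (f (fst e) - f (snd e))) = 0)"
  proof (cases "v k > 0")
    case True
    thus ?thesis using pos[OF v0] v0 by blast
  next
    case False
    have "(\<Sum>e\<in>E. - v (snd e) * c e * (f (fst e) - f (snd e))) = 0" for f
      using v0[of f] by (simp add: sum_negf)
    with False k pos[of "\<lambda>i. - v i"] show ?thesis by (intro exI[of _ "\<lambda>i. - v i"]) auto
  qed
  then obtain u where u: "\<And>i. i \<in> V \<Longrightarrow> u i > 0"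
    and u0: "\<And>f. (\<Sum>e\<in>E. u (snd e) * c e * (f (fst e) - f (snd e))) = 0" by blast
  define S where "S = (\<Sum>i\<in>V. u i)"
  have "S > 0" unfolding S_def using n_gt_1 u by (intro sum_pos) auto
  show thesis
  proof (rule that[of "\<lambda>i. u i / S"])
    show "(\<Sum>i\<in>V. u i / S) = 1" using \<open>S > 0\<close> by (simp add: S_def sum_divide_distrib[symmetric])
    fix f
    have "(\<Sum>e\<in>E. u (snd e) / S * c e * (f (fst e) - f (snd e)))
        = (\<Sum>e\<in>E. u (snd e) * c e * (f (fst e) - f (snd e))) / S"
      by (simp add: sum_divide_distrib)
    thus "(\<Sum>e\<in>E. u (snd e) / S * c e * (f (fst e) - f (snd e))) = 0" by (simp only: u0 div_0)
  qed (use u \<open>S > 0\<close> in auto)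
qed

text \<open>A Poincare inequality. An edge difference is at most the root of the form divided by
  \<open>sqrt (\<kappa> e)\<close>, and differences add up along a path. The constant depends on the
  path alone, hence is uniform in \<open>x\<close>.\<close>

lemma disagreement_bound:
  fixes \<kappa> :: "nat \<times> nat \<Rightarrow> real"
  assumes sc: "strongly_connected n E" and \<kappa>: "\<And>e. e \<in> E \<Longrightarrow> \<kappa> e > 0"
  obtains C where "C \<ge> 0" "\<And>x a b. a \<in> V \<Longrightarrow> b \<in> V \<Longrightarrow>
    \<bar>x a - x b\<bar> \<le> C * sqrt (\<Sum>e\<in>E. \<kappa> e * (x (fst e) - x (snd e))\<^sup>2)"
proof -
  define D where "D x = sqrt (\<Sum>e\<in>E. \<kappa> e * (x (fst e) - x (snd e))\<^sup>2)" for x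
  have D0: "D x \<ge> 0" for x
    unfolding D_def
    by (intro real_sqrt_ge_zero sum_nonneg mult_nonneg_nonneg) (auto intro: less_imp_le[OF \<kappa>])
  have edge: "\<bar>x (fst e) - x (snd e)\<bar> \<le> 1 / sqrt (\<kappa> e) * D x" if e: "e \<in> E" for x e
  proof -
    have "\<kappa> e * (x (fst e) - x (snd e))\<^sup>2 \<le> (\<Sum>e\<in>E. \<kappa> e * (x (fst e) - x (snd e))\<^sup>2)"
      using e by (intro member_le_sum mult_nonneg_nonneg) (auto intro: less_imp_le[OF \<kappa>])
    hence "sqrt (\<kappa> e * (x (fst e) - x (snd e))\<^sup>2) \<le> D x" unfolding D_def by (rule real_sqrt_le_mono)
    hence "sqrt (\<kappa> e) * \<bar>x (fst e) - x (snd e)\<bar> \<le> D x" by (simp add: real_sqrt_mult)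
    thus ?thesis using \<kappa>[OF e] by (simp add: field_simps)
  qed
  have "\<exists>C\<ge>0. \<forall>x. \<bar>x a - x b\<bar> \<le> C * D x" if "(a, b) \<in> E\<^sup>*" for a b
    using that
  proof (induction rule: rtrancl_induct)
    case (step b d)
    then obtain C where C: "C \<ge> 0" "\<And>x. \<bar>x a - x b\<bar> \<le> C * D x" by blast
    have "\<bar>x a - x d\<bar> \<le> (C + 1 / sqrt (\<kappa> (b, d))) * D x" for x
      using C(2)[of x] edge[OF step(2), of x] by (simp add: algebra_simps)
    moreover have "C + 1 / sqrt (\<kappa> (b, d)) \<ge> 0" using C(1) \<kappa>[OF step(2)] by simp
    ultimately show ?case by blast
  qed (auto intro: exI[of _ 0])
  hence "\<forall>z\<in>V \<times> V. \<exists>C\<ge>0. \<forall>x. \<bar>x (fst z) - x (snd z)\<bar> \<le> C * D x"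
    using sc by (auto simp: strongly_connected_def)
  then obtain C where C: "\<And>z. z \<in> V \<times> V \<Longrightarrow> C z \<ge> 0"
    "\<And>z x. z \<in> V \<times> V \<Longrightarrow> \<bar>x (fst z) - x (snd z)\<bar> \<le> C z * D x" by metis
  show thesis
  proof (rule that[of "\<Sum>z\<in>V \<times> V. C z"])
    show "(\<Sum>z\<in>V \<times> V. C z) \<ge> 0" using C(1) by (rule sum_nonneg)
    fix x a b assume ab: "a \<in> V" "b \<in> V"
    have "C (a, b) \<le> (\<Sum>z\<in>V \<times> V. C z)" using ab C(1) by (intro member_le_sum) auto
    hence "C (a, b) * D x \<le> (\<Sum>z\<in>V \<times> V. C z) * D x" using D0 by (rule mult_right_mono)
    thus "\<bar>x a - x b\<bar> \<le> (\<Sum>z\<in>V \<times> V. C z) * sqrt (\<Sum>e\<in>E. \<kappa> e * (x (fst e) - x (snd e))\<^sup>2)"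
      using C(2)[of "(a, b)" x] ab by (simp add: D_def)
  qed
qed

section \<open>Transport of the surplus and coalescence of two walkers\<close>

definition move :: "nat \<times> nat \<Rightarrow> nat \<Rightarrow> nat" where
  "move e a = (if a = fst e then snd e else a)"

text \<open>The surplus update of a step without the amount handed over to x. As a signed measure on
  the nodes, for an edge with distinct ends, it is the image of \<open>s\<close> under
  \<open>move e\<close>.\<close>

definition merge :: "nat \<times> nat \<Rightarrow> (nat \<Rightarrow> real) \<Rightarrow> nat \<Rightarrow> real" where
  "merge e s = s(snd e := s (snd e) + s (fst e), fst e := 0)"

lemma move_in: "e \<in> E \<Longrightarrow> a \<in> V \<Longrightarrow> move e a \<in> V"
  using edge_facts(2)[of e] by (auto simp: move_def)

text \<open>Change of variables for the image measure: the dynamics moves from \<open>s\<close> to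
  the test function.\<close>

lemma sum_merge:
  assumes e: "e \<in> E"
  shows "(\<Sum>a\<in>V. merge e s a * f a) = (\<Sum>a\<in>V. s a * f (move e a))"
proof -
  let ?U = "V - {fst e, snd e}"
  have V: "V = insert (fst e) (insert (snd e) ?U)" using edge_facts(1,2)[OF e] by auto
  have ne: "fst e \<noteq> snd e" using edge_facts(3)[OF e] .
  have split: "(\<Sum>a\<in>V. h a) = h (fst e) + h (snd e) + (\<Sum>a\<in>?U. h a)" for h :: "nat \<Rightarrow> real"
    by (subst V) (use ne in simp)
  have "(\<Sum>a\<in>?U. merge e s a * f a) = (\<Sum>a\<in>?U. s a * f (move e a))"
    by (rule sum.cong) (auto simp: merge_def move_def)
  thus ?thesis unfolding split using ne by (simp add: merge_def move_def algebra_simps)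
qed

text \<open>An image measure has no larger total variation, since merging can only cause
  cancellation. Testing against the signs of the merged vector reduces this to
  \<open>sum_merge\<close>.\<close>

lemma abs_merge_le:
  assumes "e \<in> E"
  shows "(\<Sum>a\<in>V. \<bar>merge e s a\<bar>) \<le> (\<Sum>a\<in>V. \<bar>s a\<bar>)"
proof -
  have "(\<Sum>a\<in>V. \<bar>merge e s a\<bar>) = (\<Sum>a\<in>V. merge e s a * sgn (merge e s a))"
    by (simp add: abs_sgn)
  also have "\<dots> = (\<Sum>a\<in>V. s a * sgn (merge e s (move e a)))" by (rule sum_merge[OF assms])
  also have "\<dots> \<le> (\<Sum>a\<in>V. \<bar>s a\<bar>)"
    by (intro sum_mono) (auto simp: sgn_if)
  finally show ?thesis .
qed

text \<open>The probability that two walkers, started at a and b and carried along by the activated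
  edges, have coalesced by time k.\<close>

primrec met :: "nat \<Rightarrow> nat \<Rightarrow> nat \<Rightarrow> real" where
  "met 0 a b = of_bool (a = b)"
| "met (Suc k) a b = (\<Sum>e\<in>E. pr e * met k (move e a) (move e b))"

lemma met_nonneg: "met k a b \<ge> 0"
  by (induction k arbitrary: a b)
     (auto intro!: sum_nonneg mult_nonneg_nonneg dest: edge_facts(4) intro: less_imp_le)

lemma met_le_1: "met k a b \<le> 1"
proof (induction k arbitrary: a b)
  case (Suc k)
  have "met (Suc k) a b \<le> (\<Sum>e\<in>E. pr e * 1)" unfolding met.simps by (intro avg_mono Suc.IH)
  thus ?case using avg_const[of 1] by simp
qed simp

lemma met_refl [simp]: "met k a a = 1"
  by (induction k arbitrary: a) (simp_all add: pr_sum)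

text \<open>Walkers that have met stay together, so the event of having met grows with
  \<open>k\<close>.\<close>

lemma met_Suc_ge: "met k a b \<le> met (Suc k) a b"
proof (induction k arbitrary: a b)
  case 0
  show ?case using met_refl[of 1 a] met_nonneg[of 1 a b] by (cases "a = b") auto
next
  case (Suc k)
  show ?case unfolding met.simps(2)[of "Suc k"] by (subst met.simps(2)) (intro avg_mono Suc.IH)
qed

text \<open>The limit of the increasing sequence is harmonic for the pair walk and equals 1 on the
  diagonal; a minimum principle excludes a minimum below 1.\<close>

lemma met_tendsto_1:
  assumes sc: "strongly_connected n E" and ab: "a \<in> V" "b \<in> V"
  shows "(\<lambda>k. met k a b) \<longlonglongrightarrow> 1"
proof -
  have "convergent (\<lambda>k. met k a b)" for a b
  proof (rule Bseq_monoseq_convergent)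
    show "Bseq (\<lambda>k. met k a b)" using met_nonneg met_le_1 by (intro BseqI'[of _ 1]) auto
    show "monoseq (\<lambda>k. met k a b)" using met_Suc_ge by (intro incseq_imp_monoseq incseq_SucI) 
  qed
  then obtain l where l: "\<And>a b. (\<lambda>k. met k a b) \<longlonglongrightarrow> l a b"
    unfolding convergent_def by metis
  have l_le: "l a b \<le> 1" for a b using l[of a b] met_le_1 by (intro LIMSEQ_le_const2[OF l]) auto
  have l_refl: "l a a = 1" for a using l[of a a] by (simp add: LIMSEQ_const_iff)
  have l_step: "l a b = (\<Sum>e\<in>E. pr e * l (move e a) (move e b))" for a b
  proof (rule LIMSEQ_unique)
    show "(\<lambda>k. met (Suc k) a b) \<longlonglongrightarrow> l a b" using l[of a b] by (rule LIMSEQ_Suc)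
    show "(\<lambda>k. met (Suc k) a b) \<longlonglongrightarrow> (\<Sum>e\<in>E. pr e * l (move e a) (move e b))"
      unfolding met.simps by (intro tendsto_intros l)
  qed
  define M where "M = Min ((\<lambda>(a, b). l a b) ` (V \<times> V))"
  have fin: "finite ((\<lambda>(a, b). l a b) ` (V \<times> V))" "(\<lambda>(a, b). l a b) ` (V \<times> V) \<noteq> {}"
    using n_gt_1 by auto
  have M_le: "M \<le> l a b" if "a \<in> V" "b \<in> V" for a b
    unfolding M_def using that fin by (intro Min_le) auto
  have "M \<in> (\<lambda>(a, b). l a b) ` (V \<times> V)" unfolding M_def using fin by (rule Min_in)
  then obtain a0 b0 where ab0: "a0 \<in> V" "b0 \<in> V" "l a0 b0 = M" by auto
  have "M \<ge> 1"
  proof (rule ccontr)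
    assume M: "\<not> M \<ge> 1"
    \<comment> \<open>The first walker is led along a path to \<open>b0\<close> while the second one
      waits there. A minimum below 1 would be passed along this path to the diagonal.\<close>
    have "(a0, b0) \<in> E\<^sup>*" using sc ab0 by (simp add: strongly_connected_def)
    hence "l a0 b0 \<noteq> M"
    proof (induction rule: converse_rtrancl_induct)
      case base
      thus ?case using l_refl M by auto
    next
      case (step c d)
      show ?case
      proof
        assume eq: "l c b0 = M"
        hence "c \<noteq> b0" using l_refl M by auto
        have c: "c \<in> V" using step(1) edges by auto
        have "(\<Sum>e\<in>E. pr e * M) < (\<Sum>e\<in>E. pr e * l (move e c) (move e b0))"
        proof (rule sum_strict_mono_ex1)
          show "\<forall>e\<in>E. pr e * M \<le> pr e * l (move e c) (move e b0)"
            by (intro ballI mult_left_mono M_le move_in c ab0(2) less_imp_le[OF edge_facts(4)])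
          have "d \<in> V" using step(1) edges by auto
          hence "l d b0 > M" using step(3) M_le[of d b0] ab0 by linarith
          \<comment> \<open>Since \<open>c \<noteq> b0\<close>, the edge \<open>(c, d)\<close> moves
            the first walker only; this single term makes the average strictly larger than
            \<open>M\<close>.\<close>
          hence "pr (c, d) * M < pr (c, d) * l (move (c, d) c) (move (c, d) b0)"
            using \<open>c \<noteq> b0\<close> edge_facts(4)[OF step(1)] by (simp add: move_def)
          thus "\<exists>e\<in>E. pr e * M < pr e * l (move e c) (move e b0)" using step(1) by blast
        qed simp
        thus False using l_step[of c b0] eq by (simp add: avg_const)
      qed
    qed
    with ab0 show False by simp
  qed
  hence "l a b = 1" using M_le[OF ab] l_le[of a b] by linarith
  thus ?thesis using l[of a b] by simp
qed

lemma met_uniformly_close_to_1: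
  assumes sc: "strongly_connected n E" and "\<tau> > 0"
  obtains K where "K \<ge> 1" "\<And>a b. a \<in> V \<Longrightarrow> b \<in> V \<Longrightarrow> 1 - met K a b \<le> \<tau>"
proof -
  have "eventually (\<lambda>k. met k (fst z) (snd z) > 1 - \<tau>) sequentially" if "z \<in> V \<times> V" for z
    using met_tendsto_1[OF sc, of "fst z" "snd z"] that \<open>\<tau> > 0\<close>
    by (intro order_tendstoD(1)) auto
  hence "eventually (\<lambda>k. \<forall>z\<in>V \<times> V. met k (fst z) (snd z) > 1 - \<tau>) sequentially"
    by (intro eventually_ball_finite) auto
  \<comment> \<open>With \<open>K \<ge> 1\<close>, the sum of \<open>merged k\<close> over
    \<open>k < K\<close> will contain \<open>merged 0\<close>, the squared norm.\<close>
  hence "eventually (\<lambda>k. (\<forall>z\<in>V \<times> V. met k (fst z) (snd z) > 1 - \<tau>) \<and> k \<ge> 1) sequentially"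
    using eventually_ge_at_top[of 1] by (rule eventually_conj)
  then obtain K where "\<forall>z\<in>V \<times> V. met K (fst z) (snd z) > 1 - \<tau>" "K \<ge> 1"
    using eventually_happens'[OF sequentially_bot] by blast
  thus thesis by (intro that[of K]) force+
qed

text \<open>The expected squared norm after k steps of the pure merging dynamics.\<close>

definition merged :: "nat \<Rightarrow> (nat \<Rightarrow> real) \<Rightarrow> real" where
  "merged k s = (\<Sum>a\<in>V. s a * (\<Sum>b\<in>V. s b * met k a b))"

lemma merged_0: "merged 0 s = (\<Sum>a\<in>V. (s a)\<^sup>2)"
  unfolding merged_def by (intro sum.cong) (auto simp: power2_eq_square)

text \<open>Moving the merging from both arguments to the kernel advances the two walkers by one
  step, and averaging over \<open>e\<close> is the recursion of \<open>met\<close>. With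
  \<open>merged_0\<close> this justifies the reading as an expected squared norm.\<close>

lemma merged_Suc: "merged (Suc k) s = (\<Sum>e\<in>E. pr e * merged k (merge e s))"
proof -
  have "(\<Sum>e\<in>E. pr e * merged k (merge e s)) =
      (\<Sum>e\<in>E. pr e * (\<Sum>a\<in>V. s a * (\<Sum>b\<in>V. s b * met k (move e a) (move e b))))"
    unfolding merged_def by (intro sum.cong refl) (simp only: sum_merge)
  also have "\<dots> = (\<Sum>e\<in>E. \<Sum>a\<in>V. \<Sum>b\<in>V. s a * (s b * (pr e * met k (move e a) (move e b))))"
    by (simp add: sum_distrib_left mult_ac)
  also have "\<dots> = (\<Sum>a\<in>V. \<Sum>e\<in>E. \<Sum>b\<in>V. s a * (s b * (pr e * met k (move e a) (move e b))))"
    by (rule sum.swap)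
  also have "\<dots> = (\<Sum>a\<in>V. \<Sum>b\<in>V. \<Sum>e\<in>E. s a * (s b * (pr e * met k (move e a) (move e b))))"
    by (intro sum.cong refl sum.swap)
  also have "\<dots> = merged (Suc k) s"
    by (simp add: merged_def sum_distrib_left mult_ac)
  finally show ?thesis by simp
qed

text \<open>As an expectation of squares the form is positive semidefinite; nonnegative entries
  alone would not give this, since \<open>s\<close> may change sign.\<close>

lemma merged_nonneg: "merged k s \<ge> 0"
  by (induction k arbitrary: s)
     (auto simp: merged_0 merged_Suc intro!: sum_nonneg mult_nonneg_nonneg dest: edge_facts(4) intro: less_imp_le)

lemma abs_sum_mult_le:
  fixes c :: real
  assumes "\<And>a. a \<in> V \<Longrightarrow> \<bar>f a\<bar> \<le> c"
  shows "\<bar>\<Sum>a\<in>V. s a * f a\<bar> \<le> c * (\<Sum>a\<in>V. \<bar>s a\<bar>)"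
proof -
  have "\<bar>\<Sum>a\<in>V. s a * f a\<bar> \<le> (\<Sum>a\<in>V. \<bar>s a * f a\<bar>)" by (rule sum_abs)
  also have "\<dots> \<le> (\<Sum>a\<in>V. \<bar>s a\<bar> * c)"
    by (intro sum_mono) (auto simp: abs_mult intro!: mult_left_mono assms)
  finally show ?thesis by (simp add: sum_distrib_left mult.commute)
qed

text \<open>If all pairs had met, the form would be the square of the sum. The defect has the
  coefficients \<open>1 - met k a b\<close>.\<close>

lemma merged_le_sum:
  assumes "\<And>a b. a \<in> V \<Longrightarrow> b \<in> V \<Longrightarrow> 1 - met k a b \<le> \<tau>"
  shows "merged k s \<le> (\<Sum>a\<in>V. s a)\<^sup>2 + \<tau> * (\<Sum>a\<in>V. \<bar>s a\<bar>)\<^sup>2"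
proof -
  let ?A = "\<Sum>a\<in>V. \<bar>s a\<bar>"
  have "\<bar>\<Sum>b\<in>V. s b * (1 - met k a b)\<bar> \<le> \<tau> * ?A" if "a \<in> V" for a
    using assms that met_le_1 by (intro abs_sum_mult_le) auto
  hence "\<bar>\<Sum>a\<in>V. s a * (\<Sum>b\<in>V. s b * (1 - met k a b))\<bar> \<le> (\<tau> * ?A) * ?A"
    by (rule abs_sum_mult_le)
  moreover have "(\<Sum>a\<in>V. s a * (\<Sum>b\<in>V. s b * (1 - met k a b))) = (\<Sum>a\<in>V. s a)\<^sup>2 - merged k s"
    by (simp add: merged_def right_diff_distrib sum_subtractf power2_eq_square sum_distrib_right)
  ultimately show ?thesis by (simp add: power2_eq_square mult.assoc)
qed

lemma merged_le: "merged k s \<le> (\<Sum>a\<in>V. \<bar>s a\<bar>)\<^sup>2"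
proof -
  have "\<bar>merged k s\<bar> \<le> (1 * (\<Sum>a\<in>V. \<bar>s a\<bar>)) * (\<Sum>a\<in>V. \<bar>s a\<bar>)"
    unfolding merged_def using met_nonneg met_le_1 by (intro abs_sum_mult_le) auto
  thus ?thesis by (simp add: power2_eq_square)
qed

lemma sum_fun_upd_diff:
  assumes "i \<in> V"
  shows "(\<Sum>a\<in>V. (s(i := s i - t)) a * f a) = (\<Sum>a\<in>V. s a * f a) - t * (f i :: real)"
proof -
  have "(\<Sum>a\<in>V. (s(i := s i - t)) a * f a) = (\<Sum>a\<in>V. s a * f a - (if a = i then t * f i else 0))"
    by (intro sum.cong) (auto simp: algebra_simps)
  thus ?thesis using assms by (simp add: sum_subtractf)
qed

lemma met_sym: "met k a b = met k b a"
  by (induction k arbitrary: a b) (auto intro!: sum.cong)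

text \<open>The effect of handing the amount \<open>t\<close> at node \<open>i\<close> from s to x.
  The two cross terms agree by symmetry of \<open>met\<close>, and \<open>met k i i = 1\<close>
  gives the quadratic term.\<close>

lemma merged_perturb:
  assumes i: "i \<in> V"
  shows "merged k (s(i := s i - t)) \<le> merged k s + 2 * \<bar>t\<bar> * (\<Sum>a\<in>V. \<bar>s a\<bar>) + t\<^sup>2"
proof -
  have "merged k (s(i := s i - t)) =
      (\<Sum>a\<in>V. (s(i := s i - t)) a * ((\<Sum>b\<in>V. s b * met k a b) - t * met k a i))"
    unfolding merged_def by (simp only: sum_fun_upd_diff[OF i])
  also have "\<dots> = (\<Sum>a\<in>V. s a * ((\<Sum>b\<in>V. s b * met k a b) - t * met k a i))
      - t * ((\<Sum>b\<in>V. s b * met k i b) - t * met k i i)"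
    by (rule sum_fun_upd_diff[OF i])
  also have "\<dots> = merged k s - t * (\<Sum>a\<in>V. s a * met k a i) - t * (\<Sum>b\<in>V. s b * met k i b) + t\<^sup>2"
    by (simp add: merged_def algebra_simps sum_subtractf sum_distrib_left power2_eq_square)
  also have "\<dots> = merged k s - 2 * (t * (\<Sum>a\<in>V. s a * met k a i)) + t\<^sup>2"
    using met_sym[of k i] by simp
  finally have eq: "merged k (s(i := s i - t)) = merged k s - 2 * (t * (\<Sum>a\<in>V. s a * met k a i)) + t\<^sup>2" .
  have "\<bar>\<Sum>a\<in>V. s a * met k a i\<bar> \<le> 1 * (\<Sum>a\<in>V. \<bar>s a\<bar>)"
    using met_nonneg met_le_1 by (intro abs_sum_mult_le) auto
  hence "\<bar>t * (\<Sum>a\<in>V. s a * met k a i)\<bar> \<le> \<bar>t\<bar> * (\<Sum>a\<in>V. \<bar>s a\<bar>)"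
    by (simp add: abs_mult mult_left_mono)
  thus ?thesis unfolding eq by linarith
qed

section \<open>Backward evolution of functions along the walk\<close>

text \<open>The expected value of \<open>q\<close> at the position, after \<open>k\<close>
  activations, of a walker started at \<open>a\<close>; dual to the expected merging of the
  surplus.\<close>

primrec evolve :: "(nat \<Rightarrow> real) \<Rightarrow> nat \<Rightarrow> nat \<Rightarrow> real" where
  "evolve q 0 a = q a"
| "evolve q (Suc k) a = (\<Sum>e\<in>E. pr e * evolve q k (move e a))"

text \<open>Averaging preserves bounds. The lower one later keeps the coefficient
  \<open>evolve inflow K 1\<close> of the negative drift at least \<open>l\<close>.\<close>

lemma evolve_bounds:
  assumes "\<And>a. a \<in> V \<Longrightarrow> l \<le> q a \<and> q a \<le> u" "a \<in> V"
  shows "l \<le> evolve q k a" "evolve q k a \<le> u"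
proof -
  have "l \<le> evolve q k a \<and> evolve q k a \<le> u" using assms(2)
  proof (induction k arbitrary: a)
    case (Suc k)
    have "(\<Sum>e\<in>E. pr e * l) \<le> evolve q (Suc k) a" "evolve q (Suc k) a \<le> (\<Sum>e\<in>E. pr e * u)"
      unfolding evolve.simps using Suc.IH[OF move_in[OF _ Suc.prems]] by (intro avg_mono, blast)+
    thus ?case by (simp add: avg_const)
  qed (use assms(1) in simp)
  thus "l \<le> evolve q k a" "evolve q k a \<le> u" by auto
qed

text \<open>Coupling: two walkers that have met stay together.\<close>

lemma evolve_coupling:
  assumes q: "\<And>a. a \<in> V \<Longrightarrow> 0 \<le> q a \<and> q a \<le> 1" and ab: "a \<in> V" "b \<in> V"
  shows "\<bar>evolve q k a - evolve q k b\<bar> \<le> 1 - met k a b"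
  using ab
proof (induction k arbitrary: a b)
  case 0
  thus ?case using q[of a] q[of b] by (cases "a = b") auto
next
  case (Suc k)
  have "\<bar>evolve q (Suc k) a - evolve q (Suc k) b\<bar> =
      \<bar>\<Sum>e\<in>E. pr e * (evolve q k (move e a) - evolve q k (move e b))\<bar>"
    by (simp add: sum_subtractf right_diff_distrib)
  also have "\<dots> \<le> (\<Sum>e\<in>E. \<bar>pr e * (evolve q k (move e a) - evolve q k (move e b))\<bar>)"
    by (rule sum_abs)
  also have "\<dots> = (\<Sum>e\<in>E. pr e * \<bar>evolve q k (move e a) - evolve q k (move e b)\<bar>)"
    by (intro sum.cong refl) (simp add: abs_mult abs_of_pos edge_facts(4))
  also have "\<dots> \<le> (\<Sum>e\<in>E. pr e * (1 - met k (move e a) (move e b)))"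
    by (intro avg_mono Suc.IH move_in Suc.prems)
  also have "\<dots> = 1 - met (Suc k) a b"
    by (simp add: right_diff_distrib sum_subtractf pr_sum)
  finally show ?case .
qed

end

section \<open>Lyapunov function\<close>

text \<open>Here D is the square root of the Dirichlet form, A the sum of the absolute values of s, and
  \<omega> - n * m the sum of s.\<close>

lemma drift_scalar_bound:
  fixes n C :: real
  assumes n: "n > 1" and l: "0 < l" "l \<le> 1" and C: "C \<ge> 0" and K: "K \<ge> 0"
    and \<zeta>: "\<zeta> = l / (2 * n)" and \<tau>: "\<tau> = l / (8 * n\<^sup>2)"
  obtains eb where "eb > 0" "eb \<le> 1" "\<And>eps D A m \<omega> f. 0 < eps \<Longrightarrow> eps < eb \<Longrightarrow> D \<ge> 0 \<Longrightarrow> A \<ge> 0 \<Longrightarrow>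
     \<bar>\<omega>\<bar> \<le> n * C * D \<Longrightarrow> l \<le> f \<Longrightarrow> f \<le> 1 \<Longrightarrow>
     - D\<^sup>2 + 2 * eps * C * D * A + eps\<^sup>2 * A\<^sup>2
     + 2 * eps * (f * m * (\<omega> - n * m) + \<tau> * \<bar>m\<bar> * A + K * (\<bar>m\<bar> + A) * (C * D + eps * A))
     + eps * \<zeta> * (- A\<^sup>2 / n + (\<omega> - n * m)\<^sup>2 + \<tau> * A\<^sup>2 + K * (2 * (C * D + eps * A) * A + (C * D + eps * A)\<^sup>2))
     \<le> - D\<^sup>2 / 2 - eps * \<zeta> / (4 * n) * (m\<^sup>2 + A\<^sup>2)"
proof -
  \<comment> \<open>Half of the rate \<open>\<zeta> / n\<close> at which \<open>A\<^sup>2\<close>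
    decays; the other half pays for the two terms with \<tau>.\<close>
  define c0 where "c0 = \<zeta> / (2 * n)"
  \<comment> \<open>After division by \<open>eps\<close>, \<open>M1\<close> collects the
    coefficients of \<open>D * (\<mu> + A)\<close>, \<open>M2\<close> those of
    \<open>D\<^sup>2\<close> and \<open>M3\<close> those of
    \<open>eps * (\<mu>\<^sup>2 + A\<^sup>2)\<close>, with \<mu> the absolute value of
    \<open>m\<close>.\<close>
  define M1 where "M1 = 2 * C + 2 * n * C + 2 * n\<^sup>2 * C + 4 * K * C"
  define M2 where "M2 = n\<^sup>2 * C\<^sup>2 + 2 * K * C\<^sup>2"
  define M3 where "M3 = 1 + 7 * K"
  have \<zeta>_pos: "\<zeta> > 0" and \<zeta>1: "\<zeta> \<le> 1" using n l by (auto simp: \<zeta> field_simps)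
  have c0: "c0 > 0" using \<zeta>_pos n by (simp add: c0_def)
  have M: "M1 \<ge> 0" "M2 \<ge> 0" "M3 > 0" using C K n by (auto simp: M1_def M2_def M3_def)
  \<comment> \<open>The second bound makes \<open>eps * M2 * D\<^sup>2\<close> at most a quarter of
    \<open>D\<^sup>2\<close>; the third lets the terms of order \<open>eps\<^sup>2\<close> consume
    at most half of the decay rate \<open>eps * c0\<close>.\<close>
  define eb where "eb = min 1 (min (1 / (4 * M2 + 4)) (c0 / (2 * (2 * M1\<^sup>2 + M3))))"
  have X: "2 * M1\<^sup>2 + M3 > 0" using M(3) by (simp add: add_nonneg_pos)
  show thesis
  proof (rule that[of eb])
    show "eb > 0" using M c0 X by (simp add: eb_def)
    show "eb \<le> 1" by (simp add: eb_def)
    fix eps D A m \<omega> f :: real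
    assume eps: "0 < eps" "eps < eb" and D: "D \<ge> 0" and A: "A \<ge> 0"
      and \<omega>: "\<bar>\<omega>\<bar> \<le> n * C * D" and f: "l \<le> f" "f \<le> 1"
    define \<mu> where "\<mu> = \<bar>m\<bar>"
    have \<mu>: "\<mu> \<ge> 0" "m\<^sup>2 = \<mu>\<^sup>2" by (auto simp: \<mu>_def)
    have eps1: "eps \<le> 1" using eps by (simp add: eb_def)
    have "eps < 1 / (4 * M2 + 4)" using eps by (simp add: eb_def)
    hence eM2: "eps * M2 \<le> 1 / 4" using M eps by (simp add: field_simps)
    have "eps < c0 / (2 * (2 * M1\<^sup>2 + M3))" using eps by (simp add: eb_def)
    hence eM3: "eps * (2 * M1\<^sup>2 + M3) \<le> c0 / 2" using X by (simp add: field_simps)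
    have mw: "\<bar>m * \<omega>\<bar> \<le> n * C * (\<mu> * D)"
    proof -
      have "\<bar>m * \<omega>\<bar> \<le> \<mu> * (n * C * D)" unfolding \<mu>_def abs_mult using \<omega> by (rule mult_left_mono) simp
      thus ?thesis by (simp add: mult_ac)
    qed
    \<comment> \<open>The source of the decay of \<open>m\<^sup>2\<close>: the lower bound
      \<open>l\<close> of \<open>f\<close> meets a surplus sum close to
      \<open>- n * m\<close>.\<close>
    have t1: "f * m * (\<omega> - n * m) \<le> n * C * (\<mu> * D) - l * n * \<mu>\<^sup>2"
    proof -
      have "f * \<bar>m * \<omega>\<bar> \<le> 1 * (n * C * (\<mu> * D))" using f l mw by (intro mult_mono) auto
      moreover have "f * (m * \<omega>) \<le> f * \<bar>m * \<omega>\<bar>" using f l by (intro mult_left_mono) auto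
      moreover have "l * (n * \<mu>\<^sup>2) \<le> f * (n * \<mu>\<^sup>2)" using f n by (intro mult_right_mono) auto
      moreover have "f * m * (\<omega> - n * m) = f * (m * \<omega>) - f * (n * \<mu>\<^sup>2)"
        unfolding \<mu>(2)[symmetric] by (simp add: algebra_simps power2_eq_square)
      ultimately show ?thesis by (simp add: mult_ac)
    qed
    have t2: "\<tau> * \<bar>m\<bar> * A \<le> \<tau> * (\<mu>\<^sup>2 / 2 + A\<^sup>2 / 2)"
    proof -
      have "\<mu> * A \<le> \<mu>\<^sup>2 / 2 + A\<^sup>2 / 2" using zero_le_power2[of "\<mu> - A"] by (simp add: power2_diff)
      moreover have "\<tau> \<ge> 0" using l by (simp add: \<tau>)
      ultimately show ?thesis unfolding \<mu>_def[symmetric] mult.assoc by (rule mult_left_mono)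
    qed
    have t3: "K * (\<bar>m\<bar> + A) * (C * D + eps * A) \<le> K * C * (D * (\<mu> + A)) + eps * (K * (3/2 * (\<mu>\<^sup>2 + A\<^sup>2)))"
    proof -
      have "2 * (\<mu> * A) \<le> \<mu>\<^sup>2 + A\<^sup>2" using zero_le_power2[of "\<mu> - A"] by (simp add: power2_diff)
      hence "\<mu> * A + A\<^sup>2 \<le> 3/2 * (\<mu>\<^sup>2 + A\<^sup>2)" using zero_le_power2[of \<mu>]
        by (simp only: ring_distribs)
      hence "eps * (K * (\<mu> * A + A\<^sup>2)) \<le> eps * (K * (3/2 * (\<mu>\<^sup>2 + A\<^sup>2)))"
        using eps K by (intro mult_left_mono) auto
      thus ?thesis by (simp add: \<mu>_def algebra_simps power2_eq_square)
    qed
    \<comment> \<open>The square of the surplus sum gives back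
      \<open>\<zeta> * n\<^sup>2 = n * l / 2\<close> times \<open>\<mu>\<^sup>2\<close>, a quarter
      of the decay \<open>2 * l * n\<close> supplied by twice \<open>t1\<close>. This is the reason
      for the size of \<zeta>.\<close>
    have t4: "\<zeta> * (\<omega> - n * m)\<^sup>2 \<le> n * l / 2 * \<mu>\<^sup>2 + 2 * n\<^sup>2 * C * (\<mu> * D) + n\<^sup>2 * C\<^sup>2 * D\<^sup>2"
    proof -
      have "\<omega>\<^sup>2 \<le> (n * C * D)\<^sup>2" using \<omega> by (metis abs_ge_zero power2_abs power_mono)
      hence w2: "\<omega>\<^sup>2 \<le> n\<^sup>2 * C\<^sup>2 * D\<^sup>2" by (simp add: power_mult_distrib)
      have "- 2 * n * (m * \<omega>) \<le> 2 * n * (n * C * (\<mu> * D))"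
      proof -
        have "- (m * \<omega>) \<le> n * C * (\<mu> * D)" using mw by linarith
        from mult_left_mono[OF this, of "2 * n"] show ?thesis using n by simp
      qed
      hence "\<omega>\<^sup>2 - 2 * n * (m * \<omega>) \<le> n\<^sup>2 * C\<^sup>2 * D\<^sup>2 + 2 * n\<^sup>2 * C * (\<mu> * D)"
        using w2 by (simp add: power2_eq_square mult_ac)
      hence "\<zeta> * (\<omega>\<^sup>2 - 2 * n * (m * \<omega>)) \<le> \<zeta> * (n\<^sup>2 * C\<^sup>2 * D\<^sup>2 + 2 * n\<^sup>2 * C * (\<mu> * D))"
        using \<zeta>_pos by (intro mult_left_mono) auto
      also have "\<dots> \<le> 1 * (n\<^sup>2 * C\<^sup>2 * D\<^sup>2 + 2 * n\<^sup>2 * C * (\<mu> * D))"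
        using \<zeta>1 C D \<mu> n by (intro mult_right_mono) auto
      finally have "\<zeta> * (\<omega>\<^sup>2 - 2 * n * (m * \<omega>)) \<le> n\<^sup>2 * C\<^sup>2 * D\<^sup>2 + 2 * n\<^sup>2 * C * (\<mu> * D)" by simp
      moreover have "\<zeta> * (\<omega> - n * m)\<^sup>2 = \<zeta> * (\<omega>\<^sup>2 - 2 * n * (m * \<omega>)) + n * l / 2 * \<mu>\<^sup>2"
        unfolding \<mu>(2)[symmetric] using n by (simp add: \<zeta> power2_diff field_simps power2_eq_square)
      ultimately show ?thesis by linarith
    qed
    have t5: "\<zeta> * (K * (2 * (C * D + eps * A) * A + (C * D + eps * A)\<^sup>2))
        \<le> 2 * K * C * (D * (\<mu> + A)) + 2 * K * C\<^sup>2 * D\<^sup>2 + eps * (4 * K * (\<mu>\<^sup>2 + A\<^sup>2))"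
    proof -
      define Y where "Y = K * (2 * (C * D + eps * A) * A + (C * D + eps * A)\<^sup>2)"
      have "Y \<ge> 0" unfolding Y_def using K C D A eps by (intro mult_nonneg_nonneg add_nonneg_nonneg) auto
      hence "\<zeta> * Y \<le> Y" using \<zeta>1 by (simp add: mult_left_le_one_le \<zeta>_pos less_imp_le)
      moreover have "2 * (C * D + eps * A) * A + (C * D + eps * A)\<^sup>2
          \<le> 2 * C * (D * (\<mu> + A)) + 2 * C\<^sup>2 * D\<^sup>2 + eps * (4 * (\<mu>\<^sup>2 + A\<^sup>2))"
      proof -
        have "(C * D + eps * A)\<^sup>2 \<le> 2 * (C * D)\<^sup>2 + 2 * (eps * A)\<^sup>2"
          using zero_le_power2[of "C * D - eps * A"] by (simp add: power2_sum power2_diff)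
        moreover have "(eps * A)\<^sup>2 \<le> eps * A\<^sup>2"
        proof -
          have "eps\<^sup>2 \<le> eps" using eps eps1 by (simp add: power2_eq_square mult_left_le)
          from mult_right_mono[OF this, of "A\<^sup>2"] show ?thesis by (simp add: power_mult_distrib)
        qed
        moreover have "0 \<le> C * (D * \<mu>)" using C D \<mu> by simp
        moreover have "0 \<le> eps * \<mu>\<^sup>2" using eps by simp
        ultimately show ?thesis by (simp add: algebra_simps power_mult_distrib power2_eq_square)
      qed
      hence "Y \<le> K * (2 * C * (D * (\<mu> + A)) + 2 * C\<^sup>2 * D\<^sup>2 + eps * (4 * (\<mu>\<^sup>2 + A\<^sup>2)))"
        unfolding Y_def using K by (rule mult_left_mono)
      ultimately show ?thesis unfolding Y_def by (simp add: algebra_simps)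
    qed
    \<comment> \<open>The value of \<tau> is \<open>\<zeta> / (4 * n)\<close>, so that, with
      \<open>\<zeta> \<le> 1\<close>, both terms with \<tau> together take at most
      \<open>\<zeta> / (2 * n)\<close>.\<close>
    have t6: "- \<zeta> * A\<^sup>2 / n + \<zeta> * \<tau> * A\<^sup>2 + \<tau> * A\<^sup>2 \<le> - c0 * A\<^sup>2"
    proof -
      have "\<tau> = \<zeta> / (4 * n)" using n by (simp add: \<tau> \<zeta> power2_eq_square)
      hence "- \<zeta> / n + \<tau> + \<tau> = - c0" using n by (simp add: c0_def field_simps)
      moreover have "\<tau> \<ge> 0" using l by (simp add: \<tau>)
      hence "\<zeta> * \<tau> \<le> \<tau>" using \<zeta>1 \<zeta>_pos by (intro mult_left_le_one_le) auto
      ultimately have "- \<zeta> / n + \<zeta> * \<tau> + \<tau> \<le> - c0" by linarith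
      from mult_right_mono[OF this, of "A\<^sup>2"] show ?thesis by (simp add: algebra_simps)
    qed
    have t7: "- 2 * l * n * \<mu>\<^sup>2 + \<tau> * \<mu>\<^sup>2 + n * l / 2 * \<mu>\<^sup>2 \<le> - c0 * \<mu>\<^sup>2"
    proof -
      have "\<tau> \<le> l * n / 4 \<and> c0 \<le> l * n / 4"
      proof -
        have "1 \<le> n ^ 3" using n by simp
        hence "l * 1 \<le> l * n ^ 3" using l by (intro mult_left_mono) auto
        thus ?thesis using n l by (auto simp: \<tau> c0_def \<zeta> field_simps power2_eq_square power3_eq_cube)
      qed
      moreover have "l * n \<ge> 0" using l n by simp
      ultimately have "- 2 * l * n + \<tau> + n * l / 2 \<le> - c0" by (simp add: mult.commute) 
      from mult_right_mono[OF this, of "\<mu>\<^sup>2"] show ?thesis by (simp add: algebra_simps)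
    qed
    \<comment> \<open>Young's inequality: an error of order \<open>eps\<close> with a factor
      \<open>D\<close> costs a quarter of \<open>D\<^sup>2\<close> and otherwise only order
      \<open>eps\<^sup>2\<close>.\<close>
    have t8: "eps * M1 * (D * (\<mu> + A)) \<le> D\<^sup>2 / 4 + 2 * eps\<^sup>2 * M1\<^sup>2 * (\<mu>\<^sup>2 + A\<^sup>2)"
    proof -
      define Z where "Z = eps * M1 * (\<mu> + A)"
      have "D * Z \<le> D\<^sup>2 / 4 + Z\<^sup>2" using zero_le_power2[of "D / 2 - Z"] by (simp add: power2_diff power_divide)
      moreover have "(\<mu> + A)\<^sup>2 \<le> 2 * (\<mu>\<^sup>2 + A\<^sup>2)" using zero_le_power2[of "\<mu> - A"] by (simp add: power2_diff power2_sum)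
      hence "Z\<^sup>2 \<le> (eps * M1)\<^sup>2 * (2 * (\<mu>\<^sup>2 + A\<^sup>2))" unfolding Z_def power_mult_distrib[of "eps * M1"]
        by (rule mult_left_mono) simp
      moreover have "eps * M1 * (D * (\<mu> + A)) = D * Z"
        "(eps * M1)\<^sup>2 * (2 * (\<mu>\<^sup>2 + A\<^sup>2)) = 2 * eps\<^sup>2 * M1\<^sup>2 * (\<mu>\<^sup>2 + A\<^sup>2)"
        by (simp_all add: Z_def power_mult_distrib algebra_simps)
      ultimately show ?thesis by linarith
    qed
    have t9: "eps * M2 * D\<^sup>2 \<le> D\<^sup>2 / 4" using mult_right_mono[OF eM2, of "D\<^sup>2"] by simp
    have t10: "eps * (eps * (2 * M1\<^sup>2 + M3)) * (\<mu>\<^sup>2 + A\<^sup>2) \<le> eps * (c0 / 2) * (\<mu>\<^sup>2 + A\<^sup>2)"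
      using eM3 eps by (intro mult_right_mono mult_left_mono) auto
    let ?B = "f * m * (\<omega> - n * m) + \<tau> * \<bar>m\<bar> * A + K * (\<bar>m\<bar> + A) * (C * D + eps * A)"
    let ?B' = "- A\<^sup>2 / n + (\<omega> - n * m)\<^sup>2 + \<tau> * A\<^sup>2 + K * (2 * (C * D + eps * A) * A + (C * D + eps * A)\<^sup>2)"
    have dA: "C * (D * A) \<le> C * (D * (\<mu> + A))" "\<mu> * D \<le> D * (\<mu> + A)"
      using C D A \<mu> by (auto simp: algebra_simps)
    have nC: "n * C * (\<mu> * D) \<le> n * C * (D * (\<mu> + A))" "2 * n\<^sup>2 * C * (\<mu> * D) \<le> 2 * n\<^sup>2 * C * (D * (\<mu> + A))"
      using dA(2) C n by (auto intro!: mult_left_mono)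
    have a2: "eps * A\<^sup>2 \<le> eps * (\<mu>\<^sup>2 + A\<^sup>2)" using eps by (intro mult_left_mono) auto
    have "2 * C * D * A + eps * A\<^sup>2 + 2 * ?B + \<zeta> * ?B' \<le>
       M1 * (D * (\<mu> + A)) + M2 * D\<^sup>2 + eps * M3 * (\<mu>\<^sup>2 + A\<^sup>2) - c0 * (\<mu>\<^sup>2 + A\<^sup>2)"
    proof -
      have B': "\<zeta> * ?B' = - \<zeta> * A\<^sup>2 / n + \<zeta> * (\<omega> - n * m)\<^sup>2 + \<zeta> * \<tau> * A\<^sup>2
          + \<zeta> * (K * (2 * (C * D + eps * A) * A + (C * D + eps * A)\<^sup>2))"
        by (simp add: algebra_simps)
      have R: "M1 * (D * (\<mu> + A)) + M2 * D\<^sup>2 + eps * M3 * (\<mu>\<^sup>2 + A\<^sup>2) - c0 * (\<mu>\<^sup>2 + A\<^sup>2)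
        = 2 * (C * (D * (\<mu> + A))) + 2 * (n * C * (D * (\<mu> + A))) + 2 * n\<^sup>2 * C * (D * (\<mu> + A)) + 2 * (K * C * (D * (\<mu> + A)))
         + 2 * K * C * (D * (\<mu> + A))
          + n\<^sup>2 * C\<^sup>2 * D\<^sup>2 + 2 * K * C\<^sup>2 * D\<^sup>2
          + eps * (\<mu>\<^sup>2 + A\<^sup>2) + 2 * (eps * (K * (3/2 * (\<mu>\<^sup>2 + A\<^sup>2)))) + eps * (4 * K * (\<mu>\<^sup>2 + A\<^sup>2))
          - c0 * \<mu>\<^sup>2 - c0 * A\<^sup>2"
        by (simp add: M1_def M2_def M3_def algebra_simps)
      have t2': "2 * (\<tau> * \<bar>m\<bar> * A) \<le> \<tau> * \<mu>\<^sup>2 + \<tau> * A\<^sup>2" using t2 by (simp add: algebra_simps)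
      have "2 * C * D * A = 2 * (C * (D * A))" by simp
      moreover have "- 2 * l * n * \<mu>\<^sup>2 = - 2 * (l * n * \<mu>\<^sup>2)" by simp
      ultimately show ?thesis unfolding B' R using t1 t2' t3 t4 t5 t6 t7 nC a2 dA(1) by argo
    qed
    hence "eps * (2 * C * D * A + eps * A\<^sup>2 + 2 * ?B + \<zeta> * ?B') \<le>
       eps * (M1 * (D * (\<mu> + A)) + M2 * D\<^sup>2 + eps * M3 * (\<mu>\<^sup>2 + A\<^sup>2) - c0 * (\<mu>\<^sup>2 + A\<^sup>2))"
      using eps by (intro mult_left_mono) auto
    also have "\<dots> = eps * M1 * (D * (\<mu> + A)) + eps * M2 * D\<^sup>2 + (eps * (eps * (2 * M1\<^sup>2 + M3)) * (\<mu>\<^sup>2 + A\<^sup>2) 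
       - 2 * eps\<^sup>2 * M1\<^sup>2 * (\<mu>\<^sup>2 + A\<^sup>2)) - eps * c0 * (\<mu>\<^sup>2 + A\<^sup>2)"
      by (simp add: algebra_simps power2_eq_square)
    also have "\<dots> \<le> D\<^sup>2 / 4 + D\<^sup>2 / 4 + eps * (c0 / 2) * (\<mu>\<^sup>2 + A\<^sup>2) - eps * c0 * (\<mu>\<^sup>2 + A\<^sup>2)"
      using t8 t9 t10 by linarith
    also have "\<dots> = D\<^sup>2 / 2 - eps * \<zeta> / (4 * n) * (m\<^sup>2 + A\<^sup>2)"
      by (simp add: c0_def \<mu>(2) field_simps)
    finally show "- D\<^sup>2 + 2 * eps * C * D * A + eps\<^sup>2 * A\<^sup>2 + 2 * eps * ?B + eps * \<zeta> * ?B'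
      \<le> - D\<^sup>2 / 2 - eps * \<zeta> / (4 * n) * (m\<^sup>2 + A\<^sup>2)"
      by (simp add: ring_distribs power2_eq_square mult.assoc)
  qed
qed

text \<open>Nonnegativity of the variance. It serves with the weights \<pi> and with uniform
  weights, where it is Cauchy-Schwarz.\<close>

lemma square_weighted_mean_le:
  fixes \<pi> x :: "'a \<Rightarrow> real"
  assumes "\<And>i. i \<in> I \<Longrightarrow> \<pi> i \<ge> 0" "(\<Sum>i\<in>I. \<pi> i) = 1"
  shows "(\<Sum>i\<in>I. \<pi> i * x i)\<^sup>2 \<le> (\<Sum>i\<in>I. \<pi> i * (x i)\<^sup>2)"
proof -
  define m where "m = (\<Sum>i\<in>I. \<pi> i * x i)"
  have "0 \<le> (\<Sum>i\<in>I. \<pi> i * (x i - m)\<^sup>2)" using assms(1) by (intro sum_nonneg) auto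
  also have "\<dots> = (\<Sum>i\<in>I. \<pi> i * (x i)\<^sup>2 - 2 * m * (\<pi> i * x i) + m\<^sup>2 * \<pi> i)"
    by (intro sum.cong) (auto simp: power2_diff algebra_simps)
  also have "\<dots> = (\<Sum>i\<in>I. \<pi> i * (x i)\<^sup>2) - 2 * m * m + m\<^sup>2 * 1"
    by (simp add: sum.distrib sum_subtractf sum_distrib_left[symmetric] assms(2) m_def[symmetric])
  finally show ?thesis by (simp add: m_def[symmetric] power2_eq_square)
qed

text \<open>Plain gossip with weight \<open>w\<close> replaces \<open>x i\<close> by a convex
  combination whose square is \<open>(1 - w) * (x i)\<^sup>2 + w * (x j)\<^sup>2 - w * (1 - w) * (x
  j - x i)\<^sup>2\<close>. Hence the rates \<open>pr e * wt e\<close> in the stationarity and the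
  extra factor \<open>1 - wt e\<close> in the Dirichlet form.\<close>

locale gossip_lyapunov = gossip_network +
  fixes \<pi> :: "nat \<Rightarrow> real" and C :: real and K :: nat and \<tau> l :: real
  assumes \<pi>_pos: "\<And>i. i \<in> V \<Longrightarrow> \<pi> i > 0"
    and \<pi>_sum: "(\<Sum>i\<in>V. \<pi> i) = 1"
    and \<pi>_stationary: "\<And>f. (\<Sum>e\<in>E. \<pi> (snd e) * (pr e * wt e) * (f (fst e) - f (snd e))) = 0"
    and C_nonneg: "C \<ge> 0"
    and disagreement: "\<And>x a b. a \<in> V \<Longrightarrow> b \<in> V \<Longrightarrow> \<bar>x a - x b\<bar> \<le>
      C * sqrt (\<Sum>e\<in>E. (\<pi> (snd e) * pr e * wt e * (1 - wt e)) * (x (fst e) - x (snd e))\<^sup>2)"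
    and K_ge_1: "K \<ge> 1"
    and met_close: "\<And>a b. a \<in> V \<Longrightarrow> b \<in> V \<Longrightarrow> 1 - met K a b \<le> \<tau>"
    and inflow_ge: "\<And>a. a \<in> V \<Longrightarrow> l \<le> (\<Sum>e\<in>E. if snd e = a then pr e * (\<pi> a * wt e) else 0)"
    and l_pos: "l > 0"
begin

text \<open>In the notation of the header, inflow is q, poisson is g and surplus is R.\<close>

definition inflow :: "nat \<Rightarrow> real" where
  "inflow a = (\<Sum>e\<in>E. if snd e = a then pr e * (\<pi> a * wt e) else 0)"
definition mean :: "(nat \<Rightarrow> real) \<Rightarrow> real" where "mean x = (\<Sum>i\<in>V. \<pi> i * x i)"
definition energy :: "(nat \<Rightarrow> real) \<Rightarrow> real" where "energy x = (\<Sum>i\<in>V. \<pi> i * (x i)\<^sup>2)"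
definition spread :: "(nat \<Rightarrow> real) \<Rightarrow> real" where
  "spread x = sqrt (\<Sum>e\<in>E. (\<pi> (snd e) * pr e * wt e * (1 - wt e)) * (x (fst e) - x (snd e))\<^sup>2)"
definition mass :: "(nat \<Rightarrow> real) \<Rightarrow> real" where "mass s = (\<Sum>a\<in>V. \<bar>s a\<bar>)"
definition poisson :: "nat \<Rightarrow> real" where "poisson a = (\<Sum>k<K. evolve inflow k a)"
definition surplus :: "(nat \<Rightarrow> real) \<Rightarrow> real" where "surplus s = (\<Sum>k<K. merged k s)"
definition \<zeta> :: real where "\<zeta> = l / (2 * real n)"
definition lyapunov :: "real \<Rightarrow> (nat \<Rightarrow> real) \<times> (nat \<Rightarrow> real) \<Rightarrow> real" where
  "lyapunov eps = (\<lambda>(x, s). energy x + 2 * eps * (mean x * (\<Sum>a\<in>V. s a * poisson a)) + eps * \<zeta> * surplus s)"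

lemma \<pi>_le_1: "i \<in> V \<Longrightarrow> \<pi> i \<le> 1"
  using \<pi>_sum member_le_sum[of i V \<pi>] \<pi>_pos by (simp add: less_imp_le)

lemma inflow_bounds: "a \<in> V \<Longrightarrow> l \<le> inflow a \<and> inflow a \<le> 1"
proof
  assume a: "a \<in> V"
  show "l \<le> inflow a" unfolding inflow_def using inflow_ge[OF a] .
  have "inflow a \<le> (\<Sum>e\<in>E. pr e * 1)" unfolding inflow_def
  proof (rule sum_mono)
    fix e assume e: "e \<in> E"
    have "\<pi> a * wt e \<le> 1 * 1" using edge_facts[OF e] \<pi>_le_1[OF a] \<pi>_pos[OF a] by (intro mult_mono) auto
    hence "pr e * (\<pi> a * wt e) \<le> pr e * 1" using edge_facts(4)[OF e] by (intro mult_left_mono) auto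
    thus "(if snd e = a then pr e * (\<pi> a * wt e) else 0) \<le> pr e * 1" using edge_facts(4)[OF e] by auto
  qed
  thus "inflow a \<le> 1" using avg_const[of 1] by simp
qed

lemma sum_inflow: "(\<Sum>e\<in>E. pr e * (\<pi> (snd e) * wt e * s (snd e))) = (\<Sum>a\<in>V. s a * inflow a)"
proof -
  have "(\<Sum>a\<in>V. s a * inflow a) = (\<Sum>a\<in>V. \<Sum>e\<in>E. if a = snd e then s a * (pr e * (\<pi> a * wt e)) else 0)"
    unfolding inflow_def sum_distrib_left by (intro sum.cong refl) auto
  also have "\<dots> = (\<Sum>e\<in>E. \<Sum>a\<in>V. if a = snd e then s a * (pr e * (\<pi> a * wt e)) else 0)"
    by (rule sum.swap)
  also have "\<dots> = (\<Sum>e\<in>E. pr e * (\<pi> (snd e) * wt e * s (snd e)))"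
    using edge_facts(2) by (intro sum.cong refl) (simp add: mult_ac)
  finally show ?thesis by simp
qed

lemma l_le_1: "l \<le> 1" using inflow_bounds[of 1] n_gt_1 by simp

lemma spread_nonneg: "spread x \<ge> 0"
  unfolding spread_def using edge_facts \<pi>_pos
  by (intro real_sqrt_ge_zero sum_nonneg mult_nonneg_nonneg) (auto simp: less_imp_le)

lemma spread_square:
  "(spread x)\<^sup>2 = (\<Sum>e\<in>E. (\<pi> (snd e) * pr e * wt e * (1 - wt e)) * (x (fst e) - x (snd e))\<^sup>2)"
  unfolding spread_def using edge_facts \<pi>_pos
  by (intro real_sqrt_pow2 sum_nonneg mult_nonneg_nonneg) (auto simp: less_imp_le)

lemma mass_nonneg: "mass s \<ge> 0" by (simp add: mass_def sum_nonneg)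

lemma abs_le_mass: "a \<in> V \<Longrightarrow> \<bar>s a\<bar> \<le> mass s"
  unfolding mass_def by (intro member_le_sum) auto

lemma mean_close:
  assumes "a \<in> V"
  shows "\<bar>x a - mean x\<bar> \<le> C * spread x"
proof -
  have "x a - mean x = (\<Sum>i\<in>V. \<pi> i * (x a - x i))"
    by (simp only: right_diff_distrib sum_subtractf sum_distrib_right[symmetric] \<pi>_sum mean_def mult_1_left)
  also have "\<bar>\<dots>\<bar> \<le> (\<Sum>i\<in>V. \<bar>\<pi> i * (x a - x i)\<bar>)" by (rule sum_abs)
  also have "\<dots> \<le> (\<Sum>i\<in>V. \<pi> i * (C * spread x))"
  proof (rule sum_mono)
    fix i assume i: "i \<in> V"
    show "\<bar>\<pi> i * (x a - x i)\<bar> \<le> \<pi> i * (C * spread x)"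
      using disagreement[OF assms i, of x] \<pi>_pos[OF i]
      by (simp add: abs_mult spread_def mult_left_mono)
  qed
  also have "\<dots> = C * spread x" by (simp only: sum_distrib_right[symmetric] \<pi>_sum mult_1_left)
  finally show ?thesis .
qed

lemma energy_upd: "i \<in> V \<Longrightarrow> energy (x(i := y)) = energy x + \<pi> i * (y\<^sup>2 - (x i)\<^sup>2)"
proof -
  assume i: "i \<in> V"
  have "energy (x(i := y)) = (\<Sum>a\<in>V. \<pi> a * (x a)\<^sup>2 + (if a = i then \<pi> i * (y\<^sup>2 - (x i)\<^sup>2) else 0))"
    unfolding energy_def by (intro sum.cong) (auto simp: algebra_simps)
  thus ?thesis using i by (simp add: sum.distrib energy_def)
qed

lemma mean_upd: "i \<in> V \<Longrightarrow> mean (x(i := x i + t)) = mean x + \<pi> i * t"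
proof -
  assume i: "i \<in> V"
  have "mean (x(i := x i + t)) = (\<Sum>a\<in>V. \<pi> a * x a + (if a = i then \<pi> i * t else 0))"
    unfolding mean_def by (intro sum.cong) (auto simp: algebra_simps)
  thus ?thesis using i by (simp add: sum.distrib mean_def)
qed

abbreviation incr :: "real \<Rightarrow> (nat \<Rightarrow> real) \<Rightarrow> (nat \<Rightarrow> real) \<Rightarrow> nat \<times> nat \<Rightarrow> real" where
  "incr eps x s e \<equiv> wt e * (x (fst e) - x (snd e)) + eps * wt e * s (snd e)"

text \<open>A step is pure merging followed by a transfer of the increment from s to x at the head.
  The estimates for s compare with pure merging and treat the transfer as a perturbation.\<close>

lemma step_eq:
  assumes "e \<in> E"
  shows "gossip_step eps w e (x, s) = (x(snd e := x (snd e) + incr eps x s e),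
    (merge e s)(snd e := merge e s (snd e) - incr eps x s e))"
  using edge_facts(3)[OF assms] by (auto simp: gossip_step_alt Let_def merge_def fun_eq_iff)

text \<open>The transfer is small in the two available senses: each part is bounded by the
  disagreement or carries a factor \<open>eps\<close>.\<close>

lemma incr_le:
  assumes "e \<in> E" "eps > 0"
  shows "\<bar>incr eps x s e\<bar> \<le> C * spread x + eps * mass s"
proof -
  note e = edge_facts[OF assms(1)]
  have "\<bar>wt e * (x (fst e) - x (snd e))\<bar> \<le> 1 * (C * spread x)"
    unfolding abs_mult using disagreement[OF e(1,2), of x] e by (intro mult_mono) (auto simp: spread_def)
  moreover have "\<bar>wt e * s (snd e)\<bar> \<le> 1 * mass s"
    unfolding abs_mult using e abs_le_mass[OF e(2)] by (intro mult_mono) auto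
  hence "\<bar>eps * (wt e * s (snd e))\<bar> \<le> eps * mass s" unfolding abs_mult using assms(2) by simp
  ultimately show ?thesis by (simp add: mult.assoc)
qed

section \<open>One-step drift of the three summands of the Lyapunov function\<close>

text \<open>Stationarity applied to the squares of \<open>x\<close> cancels the differences of
  squares, the convexity defect leaves the Dirichlet form, and in the surplus term the new value is
  replaced by \<open>mean x\<close> at a cost of \<open>C * spread x\<close>.\<close>

lemma energy_drift:
  assumes eps: "eps > 0"
  shows "(\<Sum>e\<in>E. pr e * energy (x(snd e := x (snd e) + incr eps x s e))) \<le>
    energy x - (spread x)\<^sup>2 + 2 * eps * (mean x * (\<Sum>a\<in>V. s a * inflow a))
    + 2 * eps * C * spread x * mass s + eps\<^sup>2 * (mass s)\<^sup>2"
proof -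
  \<comment> \<open>The value that plain gossip gives to the head; a convex combination, hence close
    to the mean.\<close>
  define y where "y e = (1 - wt e) * x (snd e) + wt e * x (fst e)" for e
  have y: "\<bar>y e - mean x\<bar> \<le> C * spread x" if e: "e \<in> E" for e
  proof -
    note f = edge_facts[OF e]
    have "\<bar>y e - mean x\<bar> = \<bar>(1 - wt e) * (x (snd e) - mean x) + wt e * (x (fst e) - mean x)\<bar>"
      by (simp add: y_def algebra_simps)
    also have "\<dots> \<le> \<bar>(1 - wt e) * (x (snd e) - mean x)\<bar> + \<bar>wt e * (x (fst e) - mean x)\<bar>"
      by (rule abs_triangle_ineq)
    also have "\<dots> = (1 - wt e) * \<bar>x (snd e) - mean x\<bar> + wt e * \<bar>x (fst e) - mean x\<bar>"
      using f by (simp add: abs_mult)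
    also have "\<dots> \<le> (1 - wt e) * (C * spread x) + wt e * (C * spread x)"
      using f by (intro add_mono mult_left_mono mean_close) auto
    finally show ?thesis by (simp add: algebra_simps)
  qed
  have "pr e * energy (x(snd e := x (snd e) + incr eps x s e)) \<le>
     pr e * energy x + \<pi> (snd e) * (pr e * wt e) * ((x (fst e))\<^sup>2 - (x (snd e))\<^sup>2)
     - (\<pi> (snd e) * pr e * wt e * (1 - wt e)) * (x (fst e) - x (snd e))\<^sup>2
     + 2 * eps * (mean x * (pr e * (\<pi> (snd e) * wt e * s (snd e))))
     + pr e * (2 * eps * C * spread x * mass s + eps\<^sup>2 * (mass s)\<^sup>2)" if e: "e \<in> E" for e
  proof -
    note f = edge_facts[OF e]
    define P where "P = \<pi> (snd e) * wt e"
    have P: "0 \<le> P" "P \<le> 1"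
      unfolding P_def using f \<pi>_pos[OF f(2)] \<pi>_le_1[OF f(2)] by (auto intro: mult_le_one)
    have "P * (s (snd e) * (y e - mean x)) \<le> 1 * (mass s * (C * spread x))"
    proof -
      have "P * (s (snd e) * (y e - mean x)) \<le> P * \<bar>s (snd e) * (y e - mean x)\<bar>"
        using P by (intro mult_left_mono) auto
      also have "\<dots> \<le> 1 * (mass s * (C * spread x))"
        unfolding abs_mult using P y[OF e] abs_le_mass[OF f(2), of s] mass_nonneg
        by (intro mult_mono mult_nonneg_nonneg) auto
      finally show ?thesis .
    qed
    hence b1: "2 * eps * (P * (s (snd e) * (y e - mean x))) \<le> 2 * eps * (mass s * (C * spread x))"
      using eps by (intro mult_left_mono) auto
    have "P * (wt e * (s (snd e))\<^sup>2) \<le> 1 * (1 * (mass s)\<^sup>2)"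
      using P f abs_le_mass[OF f(2), of s] by (intro mult_mono) (auto simp: abs_le_square_iff[symmetric] mass_nonneg)
    hence b2: "eps\<^sup>2 * (P * (wt e * (s (snd e))\<^sup>2)) \<le> eps\<^sup>2 * (mass s)\<^sup>2"
      by (simp add: mult_left_mono)
    have "energy (x(snd e := x (snd e) + incr eps x s e)) =
      energy x + P * ((x (fst e))\<^sup>2 - (x (snd e))\<^sup>2) - P * (1 - wt e) * (x (fst e) - x (snd e))\<^sup>2
      + 2 * eps * (mean x * (P * s (snd e))) + 2 * eps * (P * (s (snd e) * (y e - mean x)))
      + eps\<^sup>2 * (P * (wt e * (s (snd e))\<^sup>2))"
      unfolding energy_upd[OF f(2)] P_def y_def by (simp add: algebra_simps power2_eq_square)
    also have "\<dots> \<le> energy x + P * ((x (fst e))\<^sup>2 - (x (snd e))\<^sup>2) - P * (1 - wt e) * (x (fst e) - x (snd e))\<^sup>2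
      + 2 * eps * (mean x * (P * s (snd e))) + (2 * eps * C * spread x * mass s + eps\<^sup>2 * (mass s)\<^sup>2)"
      using b1 b2 by (simp add: mult_ac)
    finally have "pr e * energy (x(snd e := x (snd e) + incr eps x s e)) \<le> pr e * \<dots>"
      using f by (intro mult_left_mono) auto
    thus ?thesis unfolding P_def by (simp add: algebra_simps)
  qed
  hence "(\<Sum>e\<in>E. pr e * energy (x(snd e := x (snd e) + incr eps x s e))) \<le>
    (\<Sum>e\<in>E. pr e * energy x + \<pi> (snd e) * (pr e * wt e) * ((x (fst e))\<^sup>2 - (x (snd e))\<^sup>2)
     - (\<pi> (snd e) * pr e * wt e * (1 - wt e)) * (x (fst e) - x (snd e))\<^sup>2
     + 2 * eps * (mean x * (pr e * (\<pi> (snd e) * wt e * s (snd e))))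
     + pr e * (2 * eps * C * spread x * mass s + eps\<^sup>2 * (mass s)\<^sup>2))"
    by (rule sum_mono)
  also have "\<dots> = energy x + 0 - (spread x)\<^sup>2 + 2 * eps * (mean x * (\<Sum>a\<in>V. s a * inflow a))
    + (2 * eps * C * spread x * mass s + eps\<^sup>2 * (mass s)\<^sup>2)"
    unfolding sum.distrib sum_subtractf avg_const \<pi>_stationary[of "\<lambda>a. (x a)\<^sup>2"] spread_square
      sum_distrib_left[symmetric] sum_inflow ..
  finally show ?thesis by simp
qed

lemma poisson_bounds: "a \<in> V \<Longrightarrow> 0 \<le> poisson a \<and> poisson a \<le> K"
proof -
  assume a: "a \<in> V"
  have b: "0 \<le> evolve inflow k a" "evolve inflow k a \<le> 1" for k
    using evolve_bounds[of l inflow 1, OF inflow_bounds a, of k] l_pos by auto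
  have "poisson a \<le> (\<Sum>k<K. 1)" unfolding poisson_def using b by (intro sum_mono)
  thus ?thesis using b by (simp add: poisson_def sum_nonneg)
qed

text \<open>The sum over \<open>k\<close> telescopes. Truncation leaves
  \<open>evolve inflow K\<close>, nearly constant by coupling, where the exact Poisson equation has
  the stationary average.\<close>

lemma poisson_eq:
  "(\<Sum>e\<in>E. pr e * poisson (move e a)) = poisson a - inflow a + evolve inflow K a"
proof -
  have "(\<Sum>e\<in>E. pr e * poisson (move e a)) = (\<Sum>k<K. evolve inflow (Suc k) a)"
    unfolding poisson_def sum_distrib_left evolve.simps by (rule sum.swap)
  also have "\<dots> = poisson a + evolve inflow K a - evolve inflow 0 a"
    unfolding poisson_def using sum.lessThan_Suc_shift[of "\<lambda>k. evolve inflow k a" K] by simp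
  finally show ?thesis by simp
qed

lemma sum_poisson_le: "\<bar>\<Sum>a\<in>V. s a * poisson a\<bar> \<le> K * mass s"
  unfolding mass_def using poisson_bounds by (intro abs_sum_mult_le) auto

lemma mass_merge_le: "e \<in> E \<Longrightarrow> mass (merge e s) \<le> mass s"
  unfolding mass_def by (rule abs_merge_le)

text \<open>The term with \<open>inflow\<close> has no definite sign in \<open>energy_drift\<close>;
  in \<open>lyapunov\<close> it cancels against its negative here. A multiple of the sum of
  \<open>s\<close> takes its place.\<close>

lemma cross_drift:
  assumes eps: "eps > 0"
  shows "(\<Sum>e\<in>E. pr e * (mean (x(snd e := x (snd e) + incr eps x s e)) *
      (\<Sum>a\<in>V. ((merge e s)(snd e := merge e s (snd e) - incr eps x s e)) a * poisson a)))
    \<le> mean x * (\<Sum>a\<in>V. s a * poisson a) - mean x * (\<Sum>a\<in>V. s a * inflow a)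
      + evolve inflow K 1 * mean x * (\<Sum>a\<in>V. s a) + \<tau> * \<bar>mean x\<bar> * mass s
      + K * (\<bar>mean x\<bar> + mass s) * (C * spread x + eps * mass s)"
proof -
  let ?\<delta> = "C * spread x + eps * mass s"
  have expand: "m * (a - b + (v * c + d)) = m * a - m * b + v * m * c + m * d" for m a b c d v :: real
    by (simp add: algebra_simps)
  have "mean (x(snd e := x (snd e) + incr eps x s e)) *
      (\<Sum>a\<in>V. ((merge e s)(snd e := merge e s (snd e) - incr eps x s e)) a * poisson a)
    \<le> mean x * (\<Sum>a\<in>V. s a * poisson (move e a)) + K * (\<bar>mean x\<bar> + mass s) * ?\<delta>" if e: "e \<in> E" for e
  proof -
    note f = edge_facts[OF e]
    define \<delta> G where "\<delta> = incr eps x s e" and "G = (\<Sum>a\<in>V. merge e s a * poisson a)"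
    have \<delta>: "\<bar>\<delta>\<bar> \<le> ?\<delta>" unfolding \<delta>_def by (rule incr_le[OF e eps])
    have "\<bar>G\<bar> \<le> K * mass (merge e s)" unfolding G_def by (rule sum_poisson_le)
    also have "\<dots> \<le> K * mass s" using mass_merge_le[OF e] by (intro mult_left_mono) auto
    finally have G: "\<bar>G\<bar> \<le> K * mass s" .
    note g = poisson_bounds[OF f(2)]
    have b1: "- (mean x * \<delta> * poisson (snd e)) \<le> \<bar>mean x\<bar> * ?\<delta> * K"
    proof -
      have "- (mean x * \<delta> * poisson (snd e)) \<le> \<bar>mean x\<bar> * \<bar>\<delta>\<bar> * \<bar>poisson (snd e)\<bar>"
        unfolding abs_mult[symmetric] by simp
      also have "\<dots> \<le> \<bar>mean x\<bar> * ?\<delta> * K" using \<delta> g by (intro mult_mono) auto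
      finally show ?thesis .
    qed
    have b2: "\<pi> (snd e) * \<delta> * G \<le> ?\<delta> * (K * mass s)"
    proof -
      have "\<pi> (snd e) * \<delta> * G \<le> \<bar>\<pi> (snd e)\<bar> * \<bar>\<delta>\<bar> * \<bar>G\<bar>" unfolding abs_mult[symmetric] by simp
      also have "\<dots> \<le> 1 * ?\<delta> * (K * mass s)"
        using \<delta> G \<pi>_pos[OF f(2)] \<pi>_le_1[OF f(2)] by (intro mult_mono) auto
      finally show ?thesis by simp
    qed
    have b3: "0 \<le> \<pi> (snd e) * \<delta>\<^sup>2 * poisson (snd e)"
      using g \<pi>_pos[OF f(2)] by simp
    have "(mean x + \<pi> (snd e) * \<delta>) * (G - \<delta> * poisson (snd e)) =
        mean x * G + - (mean x * \<delta> * poisson (snd e)) + \<pi> (snd e) * \<delta> * G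
        - \<pi> (snd e) * \<delta>\<^sup>2 * poisson (snd e)"
      by (simp add: algebra_simps power2_eq_square)
    also have "\<dots> \<le> mean x * G + \<bar>mean x\<bar> * ?\<delta> * K + ?\<delta> * (K * mass s)"
      using b1 b2 b3 by linarith
    also have "\<dots> = mean x * G + K * (\<bar>mean x\<bar> + mass s) * ?\<delta>" by (simp add: algebra_simps)
    finally show ?thesis
      unfolding mean_upd[OF f(2)] sum_fun_upd_diff[OF f(2)] \<delta>_def[symmetric] G_def[symmetric]
      by (simp only: G_def sum_merge[OF e])
  qed
  hence "(\<Sum>e\<in>E. pr e * (mean (x(snd e := x (snd e) + incr eps x s e)) *
      (\<Sum>a\<in>V. ((merge e s)(snd e := merge e s (snd e) - incr eps x s e)) a * poisson a)))
     \<le> (\<Sum>e\<in>E. pr e * (mean x * (\<Sum>a\<in>V. s a * poisson (move e a)) + K * (\<bar>mean x\<bar> + mass s) * ?\<delta>))"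
    by (rule avg_mono)
  also have "\<dots> = (\<Sum>e\<in>E. pr e * (mean x * (\<Sum>a\<in>V. s a * poisson (move e a)))) + K * (\<bar>mean x\<bar> + mass s) * ?\<delta>"
    by (simp only: ring_distribs(1) sum.distrib avg_const)
  also have "(\<Sum>e\<in>E. pr e * (mean x * (\<Sum>a\<in>V. s a * poisson (move e a)))) =
      mean x * (\<Sum>a\<in>V. s a * (\<Sum>e\<in>E. pr e * poisson (move e a)))"
  proof -
    have "(\<Sum>e\<in>E. pr e * (mean x * (\<Sum>a\<in>V. s a * poisson (move e a)))) =
        mean x * (\<Sum>e\<in>E. \<Sum>a\<in>V. s a * (pr e * poisson (move e a)))"
      unfolding sum_distrib_left by (intro sum.cong refl) (simp add: mult_ac)
    also have "(\<Sum>e\<in>E. \<Sum>a\<in>V. s a * (pr e * poisson (move e a))) = (\<Sum>a\<in>V. \<Sum>e\<in>E. s a * (pr e * poisson (move e a)))"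
      by (rule sum.swap)
    finally show ?thesis by (simp only: sum_distrib_left)
  qed
  also have "(\<Sum>a\<in>V. s a * (\<Sum>e\<in>E. pr e * poisson (move e a))) =
     (\<Sum>a\<in>V. s a * poisson a) - (\<Sum>a\<in>V. s a * inflow a) + (\<Sum>a\<in>V. s a * evolve inflow K a)"
    unfolding poisson_eq by (simp add: algebra_simps sum.distrib sum_subtractf)
  \<comment> \<open>Node 1 is an arbitrary reference point; by coupling the values at the other
    nodes differ from it by at most \<tau>.\<close>
  also have "(\<Sum>a\<in>V. s a * evolve inflow K a) =
     evolve inflow K 1 * (\<Sum>a\<in>V. s a) + (\<Sum>a\<in>V. s a * (evolve inflow K a - evolve inflow K 1))"
    by (simp only: right_diff_distrib sum_subtractf sum_distrib_right[symmetric]) (simp add: mult.commute)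
  finally have le: "(\<Sum>e\<in>E. pr e * (mean (x(snd e := x (snd e) + incr eps x s e)) *
      (\<Sum>a\<in>V. ((merge e s)(snd e := merge e s (snd e) - incr eps x s e)) a * poisson a)))
    \<le> mean x * (\<Sum>a\<in>V. s a * poisson a) - mean x * (\<Sum>a\<in>V. s a * inflow a)
      + evolve inflow K 1 * mean x * (\<Sum>a\<in>V. s a)
      + mean x * (\<Sum>a\<in>V. s a * (evolve inflow K a - evolve inflow K 1))
      + K * (\<bar>mean x\<bar> + mass s) * ?\<delta>"
    unfolding expand .
  have "1 \<in> V" using n_gt_1 by simp
  have "\<bar>evolve inflow K a - evolve inflow K 1\<bar> \<le> \<tau>" if a: "a \<in> V" for a
  proof -
    have "0 \<le> inflow b \<and> inflow b \<le> 1" if "b \<in> V" for b using inflow_bounds[OF that] l_pos by linarith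
    from evolve_coupling[of inflow, OF this a \<open>1 \<in> V\<close>, of K] met_close[OF a \<open>1 \<in> V\<close>] show ?thesis by linarith
  qed
  hence "\<bar>\<Sum>a\<in>V. s a * (evolve inflow K a - evolve inflow K 1)\<bar> \<le> \<tau> * mass s"
    unfolding mass_def by (rule abs_sum_mult_le)
  hence "\<bar>mean x\<bar> * \<bar>\<Sum>a\<in>V. s a * (evolve inflow K a - evolve inflow K 1)\<bar> \<le> \<bar>mean x\<bar> * (\<tau> * mass s)"
    by (rule mult_left_mono) simp
  hence "mean x * (\<Sum>a\<in>V. s a * (evolve inflow K a - evolve inflow K 1)) \<le> \<tau> * \<bar>mean x\<bar> * mass s"
    unfolding abs_mult[symmetric] by (simp add: mult_ac)
  with le show ?thesis by linarith
qed

text \<open>Under pure merging the sum telescopes to \<open>merged K s - merged 0 s\<close>: the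
  squared norm is lost, and by coalescence little more than the square of the sum comes back. The
  last summand pays for the transfer to x.\<close>

lemma surplus_drift:
  assumes eps: "eps > 0"
  shows "(\<Sum>e\<in>E. pr e * surplus ((merge e s)(snd e := merge e s (snd e) - incr eps x s e)))
    \<le> surplus s - (\<Sum>a\<in>V. (s a)\<^sup>2) + (\<Sum>a\<in>V. s a)\<^sup>2 + \<tau> * (mass s)\<^sup>2
      + K * (2 * (C * spread x + eps * mass s) * mass s + (C * spread x + eps * mass s)\<^sup>2)"
proof -
  let ?\<delta> = "C * spread x + eps * mass s"
  let ?B = "2 * ?\<delta> * mass s + ?\<delta>\<^sup>2"
  have "surplus ((merge e s)(snd e := merge e s (snd e) - incr eps x s e)) \<le> surplus (merge e s) + K * ?B"
    if e: "e \<in> E" for e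
  proof -
    note \<delta> = incr_le[OF e eps, of x s]
    have "merged k ((merge e s)(snd e := merge e s (snd e) - incr eps x s e)) \<le> merged k (merge e s) + ?B" for k
    proof -
      have "2 * \<bar>incr eps x s e\<bar> * mass (merge e s) \<le> 2 * ?\<delta> * mass s"
        using \<delta> mass_merge_le[OF e] mass_nonneg by (intro mult_mono) auto
      moreover have "(incr eps x s e)\<^sup>2 \<le> ?\<delta>\<^sup>2"
        using power_mono[OF \<delta> abs_ge_zero, of 2] by simp
      ultimately show ?thesis
        using merged_perturb[OF edge_facts(2)[OF e], of k "merge e s" "incr eps x s e"]
        unfolding mass_def[symmetric] by linarith
    qed
    hence "surplus ((merge e s)(snd e := merge e s (snd e) - incr eps x s e)) \<le> (\<Sum>k<K. merged k (merge e s) + ?B)"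
      unfolding surplus_def by (intro sum_mono)
    also have "\<dots> = surplus (merge e s) + K * ?B" by (simp add: sum.distrib surplus_def algebra_simps)
    finally show ?thesis .
  qed
  hence "(\<Sum>e\<in>E. pr e * surplus ((merge e s)(snd e := merge e s (snd e) - incr eps x s e)))
      \<le> (\<Sum>e\<in>E. pr e * (surplus (merge e s) + K * ?B))"
    by (rule avg_mono)
  also have "\<dots> = (\<Sum>e\<in>E. pr e * surplus (merge e s)) + K * ?B"
    by (simp only: ring_distribs(1) sum.distrib avg_const)
  also have "(\<Sum>e\<in>E. pr e * surplus (merge e s)) = (\<Sum>k<K. merged (Suc k) s)"
    unfolding surplus_def sum_distrib_left merged_Suc by (rule sum.swap)
  also have "\<dots> = surplus s + merged K s - merged 0 s"
    unfolding surplus_def using sum.lessThan_Suc_shift[of "\<lambda>k. merged k s" K] by simp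
  finally show ?thesis using merged_le_sum[of K \<tau> s, OF met_close]
    unfolding mass_def[symmetric] merged_0 by linarith
qed

section \<open>Comparison of the quadratic forms and contraction\<close>

lemma mass_square_le: "(mass s)\<^sup>2 / n \<le> (\<Sum>a\<in>V. (s a)\<^sup>2)"
proof -
  have "(\<Sum>a\<in>V. 1 / real n * \<bar>s a\<bar>)\<^sup>2 \<le> (\<Sum>a\<in>V. 1 / real n * \<bar>s a\<bar>\<^sup>2)"
    using n_gt_1 by (intro square_weighted_mean_le) auto
  hence "(1 / real n * mass s)\<^sup>2 \<le> 1 / real n * (\<Sum>a\<in>V. (s a)\<^sup>2)"
    by (simp only: sum_distrib_left[symmetric] mass_def power2_abs)
  thus ?thesis using n_gt_1 by (simp add: field_simps power2_eq_square)
qed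

lemma mean_square_le_energy: "(mean x)\<^sup>2 \<le> energy x"
  unfolding mean_def energy_def using \<pi>_pos \<pi>_sum by (intro square_weighted_mean_le) (auto simp: less_imp_le)

text \<open>The drift is negative in terms of spread, mean and mass; this bound turns it into a
  fraction of the energy.\<close>

lemma energy_le: "energy x \<le> 2 * (mean x)\<^sup>2 + 2 * C\<^sup>2 * (spread x)\<^sup>2"
proof -
  have "energy x \<le> (\<Sum>i\<in>V. \<pi> i * (2 * (mean x)\<^sup>2 + 2 * C\<^sup>2 * (spread x)\<^sup>2))" unfolding energy_def
  proof (intro sum_mono mult_left_mono)
    fix i assume i: "i \<in> V"
    have "(x i - mean x)\<^sup>2 \<le> (C * spread x)\<^sup>2"
      using power_mono[OF mean_close[OF i, of x] abs_ge_zero, of 2] by simp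
    moreover have "(x i)\<^sup>2 \<le> 2 * (mean x)\<^sup>2 + 2 * (x i - mean x)\<^sup>2"
      using zero_le_power2[of "x i - 2 * mean x"] by (simp add: power2_diff power_mult_distrib)
    ultimately show "(x i)\<^sup>2 \<le> 2 * (mean x)\<^sup>2 + 2 * C\<^sup>2 * (spread x)\<^sup>2" by (simp add: power_mult_distrib)
  qed (use \<pi>_pos in \<open>auto simp: less_imp_le\<close>)
  thus ?thesis by (simp only: sum_distrib_right[symmetric] \<pi>_sum mult_1_left)
qed

lemma surplus_bounds: "(\<Sum>a\<in>V. (s a)\<^sup>2) \<le> surplus s" "surplus s \<le> K * (mass s)\<^sup>2"
proof -
  have "merged 0 s \<le> surplus s"
    unfolding surplus_def using K_ge_1 merged_nonneg by (intro member_le_sum) auto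
  thus "(\<Sum>a\<in>V. (s a)\<^sup>2) \<le> surplus s" by (simp add: merged_0)
  have "surplus s \<le> (\<Sum>k<K. (mass s)\<^sup>2)"
    unfolding surplus_def mass_def by (intro sum_mono merged_le)
  thus "surplus s \<le> K * (mass s)\<^sup>2" by simp
qed

lemma sum_conserved:
  assumes "e \<in> E" "(\<Sum>a\<in>V. x a) + (\<Sum>a\<in>V. s a) = 0"
  shows "(\<Sum>a\<in>V. fst (gossip_step eps w e (x, s)) a) + (\<Sum>a\<in>V. snd (gossip_step eps w e (x, s)) a) = 0"
proof -
  note f = edge_facts[OF assms(1)]
  have "(\<Sum>a\<in>V. (x(snd e := x (snd e) + t)) a) = (\<Sum>a\<in>V. x a) + t" for t
    using sum_fun_upd_diff[OF f(2), of x "- t" "\<lambda>_. 1"] by simp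
  moreover have "(\<Sum>a\<in>V. ((merge e s)(snd e := merge e s (snd e) - t)) a) = (\<Sum>a\<in>V. merge e s a) - t" for t
    using sum_fun_upd_diff[OF f(2), of "merge e s" t "\<lambda>_. 1"] by simp
  moreover have "(\<Sum>a\<in>V. merge e s a) = (\<Sum>a\<in>V. s a)"
    using sum_merge[OF assms(1), of s "\<lambda>_. 1"] by simp
  ultimately show ?thesis unfolding step_eq[OF assms(1)] fst_conv snd_conv using assms(2) by simp
qed

text \<open>The drift is at most \<open>- c1\<close> times, and the Lyapunov function at most
  \<open>M\<close> times, one and the same form in spread, mean and mass; this gives the factor
  \<open>1 - c1 / M\<close>. As \<open>eps\<close> tends to 0, this factor tends to 1 and
  \<open>c\<close> to 0; only the threshold is uniform.\<close>

lemma exists_lyapunov_threshold: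
  assumes \<tau>: "\<tau> = l / (8 * (real n)\<^sup>2)"
  obtains eb where "eb > 0" "\<And>eps. 0 < eps \<Longrightarrow> eps < eb \<Longrightarrow> \<exists>\<rho> c. 0 \<le> \<rho> \<and> \<rho> < 1 \<and> 0 < c \<and>
    (\<forall>x s. (\<Sum>a\<in>V. x a) + (\<Sum>a\<in>V. s a) = 0 \<longrightarrow>
      (\<Sum>e\<in>E. pr e * lyapunov eps (gossip_step eps w e (x, s))) \<le> \<rho> * lyapunov eps (x, s)) \<and>
    (\<forall>x s. c * (energy x + (mass s)\<^sup>2) \<le> lyapunov eps (x, s))"
proof -
  define c0 where "c0 = \<zeta> / (2 * real n)"
  have c0: "c0 > 0" "\<zeta> > 0" "\<zeta> \<le> 1" using l_pos l_le_1 n_gt_1 by (auto simp: c0_def \<zeta>_def field_simps)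
  have n1: "1 < real n" using n_gt_1 by simp
  obtain eb0 where eb0: "eb0 > 0" "eb0 \<le> 1" and bound: "\<And>(eps::real) (D::real) (A::real) (m::real) (\<omega>::real) f. 0 < eps \<Longrightarrow> eps < eb0 \<Longrightarrow> D \<ge> 0 \<Longrightarrow> A \<ge> 0 \<Longrightarrow>
     \<bar>\<omega>\<bar> \<le> n * C * D \<Longrightarrow> l \<le> f \<Longrightarrow> f \<le> 1 \<Longrightarrow>
     - D\<^sup>2 + 2 * eps * C * D * A + eps\<^sup>2 * A\<^sup>2
     + 2 * eps * (f * m * (\<omega> - n * m) + \<tau> * \<bar>m\<bar> * A + K * (\<bar>m\<bar> + A) * (C * D + eps * A))
     + eps * \<zeta> * (- A\<^sup>2 / n + (\<omega> - n * m)\<^sup>2 + \<tau> * A\<^sup>2 + K * (2 * (C * D + eps * A) * A + (C * D + eps * A)\<^sup>2))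
     \<le> - D\<^sup>2 / 2 - eps * \<zeta> / (4 * real n) * (m\<^sup>2 + A\<^sup>2)"
    using drift_scalar_bound[OF n1 l_pos l_le_1 C_nonneg of_nat_0_le_iff[of K] \<zeta>_def \<tau>] by blast
  \<comment> \<open>The second bound is for positivity: the cross term then takes at most half of
    the energy and half of the lower bound of the surplus term.\<close>
  define eb where "eb = min eb0 (c0 / (2 * (real K)\<^sup>2))"
  show thesis
  proof (rule that[of eb])
    show "eb > 0" using eb0 c0 K_ge_1 by (simp add: eb_def)
    fix eps assume eps: "0 < eps" "eps < eb"
    hence eps1: "eps < eb0" "eps \<le> 1" using eb0 by (auto simp: eb_def)
    have "eps < c0 / (2 * (real K)\<^sup>2)" using eps by (simp add: eb_def)
    hence epsK: "eps * ((real K)\<^sup>2 / c0) \<le> 1 / 2" using c0 K_ge_1 by (simp add: field_simps)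
    define M where "M = 2 + 2 * C\<^sup>2 + 2 * real K"
    define c1 where "c1 = min (1 / 2) (eps * c0 / 2)"
    have c1: "0 < c1" "c1 \<le> 1 / 2" "c1 \<le> eps * c0 / 2" using eps c0 by (auto simp: c1_def)
    have "M \<ge> 2" by (simp add: M_def)
    define c where "c = min (1 / 2) (eps * c0)"
    have c: "0 < c" "c \<le> 1 / 2" "c \<le> eps * c0" using eps c0 by (auto simp: c_def)
    have cross: "\<bar>2 * eps * (mean x * (\<Sum>a\<in>V. s a * poisson a))\<bar> \<le> 2 * eps * (K * (\<bar>mean x\<bar> * mass s))" for x s
    proof -
      have "\<bar>mean x\<bar> * \<bar>\<Sum>a\<in>V. s a * poisson a\<bar> \<le> \<bar>mean x\<bar> * (K * mass s)"
        by (intro mult_left_mono sum_poisson_le) simp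
      hence "2 * eps * (\<bar>mean x\<bar> * \<bar>\<Sum>a\<in>V. s a * poisson a\<bar>) \<le> 2 * eps * (\<bar>mean x\<bar> * (K * mass s))"
        by (rule mult_left_mono) (use eps in simp)
      thus ?thesis using eps by (simp add: abs_mult mult_ac)
    qed
    have upper: "lyapunov eps (x, s) \<le> M * ((spread x)\<^sup>2 + (mean x)\<^sup>2 + (mass s)\<^sup>2)" for x s
    proof -
      have "2 * \<bar>mean x\<bar> * mass s \<le> (mean x)\<^sup>2 + (mass s)\<^sup>2"
        using sum_squares_bound[of "\<bar>mean x\<bar>" "mass s"] by simp
      hence "K * (2 * \<bar>mean x\<bar> * mass s) \<le> K * ((mean x)\<^sup>2 + (mass s)\<^sup>2)"
        by (intro mult_left_mono) auto
      hence "2 * (K * (\<bar>mean x\<bar> * mass s)) \<le> K * ((mean x)\<^sup>2 + (mass s)\<^sup>2)" by (simp add: mult_ac)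
      moreover have "eps * (2 * (K * (\<bar>mean x\<bar> * mass s))) \<le> 1 * (2 * (K * (\<bar>mean x\<bar> * mass s)))"
        using eps1 mass_nonneg by (intro mult_right_mono) auto
      moreover have "eps * \<zeta> * surplus s \<le> 1 * (K * (mass s)\<^sup>2)"
        using surplus_bounds[of s] eps eps1 c0 sum_nonneg[of V "\<lambda>a. (s a)\<^sup>2"]
        by (intro mult_mono mult_le_one) auto
      ultimately have "lyapunov eps (x, s) \<le> 2 * (mean x)\<^sup>2 + 2 * C\<^sup>2 * (spread x)\<^sup>2
          + K * ((mean x)\<^sup>2 + (mass s)\<^sup>2) + K * (mass s)\<^sup>2"
        using energy_le[of x] cross[of x s] unfolding lyapunov_def split_conv by linarith
      also have "\<dots> = (2 * C\<^sup>2) * (spread x)\<^sup>2 + (2 + K) * (mean x)\<^sup>2 + (2 * K) * (mass s)\<^sup>2"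
        by (simp add: algebra_simps)
      also have "\<dots> \<le> M * (spread x)\<^sup>2 + M * (mean x)\<^sup>2 + M * (mass s)\<^sup>2"
        by (intro add_mono mult_right_mono) (auto simp: M_def)
      finally show ?thesis by (simp add: algebra_simps)
    qed
    have lower: "c * (energy x + (mass s)\<^sup>2) \<le> lyapunov eps (x, s)" for x s
    proof -
      have am: "2 * (K * (\<bar>mean x\<bar> * mass s)) \<le> c0 * (mass s)\<^sup>2 + (real K)\<^sup>2 / c0 * (mean x)\<^sup>2"
      proof -
        have "0 \<le> (c0 * mass s - K * \<bar>mean x\<bar>)\<^sup>2 / c0" using c0 by simp
        also have "\<dots> = c0 * (mass s)\<^sup>2 + (real K)\<^sup>2 / c0 * (mean x)\<^sup>2 - 2 * (K * (\<bar>mean x\<bar> * mass s))"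
          using c0 by (simp add: power2_diff power_mult_distrib field_simps power2_eq_square)
        finally show ?thesis by simp
      qed
      have "eps * (2 * (K * (\<bar>mean x\<bar> * mass s))) \<le> eps * (c0 * (mass s)\<^sup>2 + (real K)\<^sup>2 / c0 * (mean x)\<^sup>2)"
        using eps am by (intro mult_left_mono) auto
      also have "\<dots> = eps * c0 * (mass s)\<^sup>2 + eps * ((real K)\<^sup>2 / c0) * (mean x)\<^sup>2" by (simp add: algebra_simps)
      also have "eps * ((real K)\<^sup>2 / c0) * (mean x)\<^sup>2 \<le> 1 / 2 * energy x"
        using epsK mean_square_le_energy[of x] eps c0 by (intro mult_mono) auto
      finally have x: "2 * eps * (K * (\<bar>mean x\<bar> * mass s)) \<le> eps * c0 * (mass s)\<^sup>2 + 1 / 2 * energy x" by simp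
      have "(mass s)\<^sup>2 / n \<le> surplus s" using mass_square_le[of s] surplus_bounds(1)[of s] by linarith
      hence "eps * \<zeta> * ((mass s)\<^sup>2 / n) \<le> eps * \<zeta> * surplus s" using eps c0 by (intro mult_left_mono) auto
      moreover have "eps * \<zeta> * ((mass s)\<^sup>2 / n) = 2 * (eps * c0 * (mass s)\<^sup>2)" by (simp add: c0_def)
      ultimately have "1 / 2 * energy x + eps * c0 * (mass s)\<^sup>2 \<le> lyapunov eps (x, s)"
        using cross[of x s] x unfolding lyapunov_def split_conv by linarith
      moreover have "0 \<le> energy x" using mean_square_le_energy[of x] by (meson order_trans zero_le_power2)
      hence "c * energy x \<le> 1 / 2 * energy x" using c by (intro mult_right_mono)
      moreover have "c * (mass s)\<^sup>2 \<le> eps * c0 * (mass s)\<^sup>2" using c by (intro mult_right_mono) auto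
      ultimately show ?thesis by (simp add: ring_distribs(1))
    qed
    have drift: "(\<Sum>e\<in>E. pr e * lyapunov eps (gossip_step eps w e (x, s))) \<le> (1 - c1 / M) * lyapunov eps (x, s)"
      if zero: "(\<Sum>a\<in>V. x a) + (\<Sum>a\<in>V. s a) = 0" for x s
    proof -
      define D A m where "D = spread x" and "A = mass s" and "m = mean x"
      \<comment> \<open>The deviation of the surplus sum from \<open>- n * m\<close>. Since the
        total vanishes, it equals minus the sum of \<open>x a - m\<close> and is controlled by the
        disagreement.\<close>
      define \<omega> where "\<omega> = (\<Sum>a\<in>V. s a) + n * m"
      have \<sigma>: "(\<Sum>a\<in>V. s a) = \<omega> - n * m" by (simp add: \<omega>_def)
      have "\<omega> = - (\<Sum>a\<in>V. x a - m)" using zero by (simp add: \<omega>_def sum_subtractf)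
      hence "\<bar>\<omega>\<bar> \<le> (\<Sum>a\<in>V. \<bar>x a - m\<bar>)" using sum_abs[of "\<lambda>a. x a - m" V] by simp
      also have "\<dots> \<le> (\<Sum>a\<in>V. C * D)" unfolding m_def D_def by (intro sum_mono mean_close)
      finally have \<omega>: "\<bar>\<omega>\<bar> \<le> n * C * D" by simp
      have "1 \<in> V" using n_gt_1 by simp
      note f = evolve_bounds[of l inflow 1, OF inflow_bounds this, of K]
      let ?x = "\<lambda>e. x(snd e := x (snd e) + incr eps x s e)"
      let ?s = "\<lambda>e. (merge e s)(snd e := merge e s (snd e) - incr eps x s e)"
      have "(\<Sum>e\<in>E. pr e * lyapunov eps (gossip_step eps w e (x, s))) =
          (\<Sum>e\<in>E. pr e * energy (?x e) + 2 * eps * (pr e * (mean (?x e) * (\<Sum>a\<in>V. ?s e a * poisson a)))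
            + eps * \<zeta> * (pr e * surplus (?s e)))"
        by (intro sum.cong refl) (simp only: step_eq lyapunov_def split_conv ring_distribs(1) mult_ac)
      also have "\<dots> = (\<Sum>e\<in>E. pr e * energy (?x e)) + 2 * eps * (\<Sum>e\<in>E. pr e * (mean (?x e) * (\<Sum>a\<in>V. ?s e a * poisson a)))
            + eps * \<zeta> * (\<Sum>e\<in>E. pr e * surplus (?s e))"
        unfolding sum.distrib sum_distrib_left[symmetric] ..
      also have "\<dots> \<le> (energy x - D\<^sup>2 + 2 * eps * (m * (\<Sum>a\<in>V. s a * inflow a)) + 2 * eps * C * D * A + eps\<^sup>2 * A\<^sup>2)
          + 2 * eps * (m * (\<Sum>a\<in>V. s a * poisson a) - m * (\<Sum>a\<in>V. s a * inflow a)
             + evolve inflow K 1 * m * (\<omega> - n * m) + \<tau> * \<bar>m\<bar> * A + K * (\<bar>m\<bar> + A) * (C * D + eps * A))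
          + eps * \<zeta> * (surplus s - A\<^sup>2 / n + (\<omega> - n * m)\<^sup>2 + \<tau> * A\<^sup>2
             + K * (2 * (C * D + eps * A) * A + (C * D + eps * A)\<^sup>2))"
      proof (intro add_mono mult_left_mono)
        show "(\<Sum>e\<in>E. pr e * energy (?x e)) \<le> energy x - D\<^sup>2 + 2 * eps * (m * (\<Sum>a\<in>V. s a * inflow a)) + 2 * eps * C * D * A + eps\<^sup>2 * A\<^sup>2"
          unfolding D_def A_def m_def by (rule energy_drift[OF eps(1)])
        show "(\<Sum>e\<in>E. pr e * (mean (?x e) * (\<Sum>a\<in>V. ?s e a * poisson a))) \<le>
           m * (\<Sum>a\<in>V. s a * poisson a) - m * (\<Sum>a\<in>V. s a * inflow a)
             + evolve inflow K 1 * m * (\<omega> - n * m) + \<tau> * \<bar>m\<bar> * A + K * (\<bar>m\<bar> + A) * (C * D + eps * A)"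
          unfolding \<sigma>[symmetric] unfolding D_def A_def m_def by (rule cross_drift[OF eps(1)])
        show "(\<Sum>e\<in>E. pr e * surplus (?s e)) \<le> surplus s - A\<^sup>2 / n + (\<omega> - n * m)\<^sup>2 + \<tau> * A\<^sup>2
             + K * (2 * (C * D + eps * A) * A + (C * D + eps * A)\<^sup>2)"
          using surplus_drift[OF eps(1), of s x] mass_square_le[of s]
          unfolding \<sigma>[symmetric] unfolding D_def A_def m_def by linarith
      qed (use eps c0 in auto)
      also have "\<dots> = lyapunov eps (x, s) + (- D\<^sup>2 + 2 * eps * C * D * A + eps\<^sup>2 * A\<^sup>2
         + 2 * eps * (evolve inflow K 1 * m * (\<omega> - n * m) + \<tau> * \<bar>m\<bar> * A + K * (\<bar>m\<bar> + A) * (C * D + eps * A))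
         + eps * \<zeta> * (- A\<^sup>2 / n + (\<omega> - n * m)\<^sup>2 + \<tau> * A\<^sup>2 + K * (2 * (C * D + eps * A) * A + (C * D + eps * A)\<^sup>2)))"
        unfolding lyapunov_def split_conv m_def[symmetric] by (simp only: ring_distribs)
      also have "\<dots> \<le> lyapunov eps (x, s) + (- D\<^sup>2 / 2 - eps * \<zeta> / (4 * real n) * (m\<^sup>2 + A\<^sup>2))"
        using \<omega> f by (intro add_left_mono bound eps(1) eps1(1)) (auto simp: D_def A_def spread_nonneg mass_nonneg)
      also have "\<dots> \<le> lyapunov eps (x, s) - c1 * (D\<^sup>2 + m\<^sup>2 + A\<^sup>2)"
      proof -
        have "c1 * D\<^sup>2 \<le> 1 / 2 * D\<^sup>2" using c1 by (intro mult_right_mono) auto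
        moreover have "c1 * (m\<^sup>2 + A\<^sup>2) \<le> eps * c0 / 2 * (m\<^sup>2 + A\<^sup>2)" using c1 by (intro mult_right_mono) auto
        moreover have "eps * c0 / 2 * (m\<^sup>2 + A\<^sup>2) = eps * \<zeta> / (4 * real n) * (m\<^sup>2 + A\<^sup>2)" by (simp add: c0_def)
        ultimately show ?thesis by (simp add: ring_distribs(1))
      qed
      also have "\<dots> \<le> lyapunov eps (x, s) - c1 / M * lyapunov eps (x, s)"
      proof -
        have "c1 / M * lyapunov eps (x, s) \<le> c1 / M * (M * (D\<^sup>2 + m\<^sup>2 + A\<^sup>2))"
          unfolding D_def m_def A_def using c1 \<open>M \<ge> 2\<close> by (intro mult_left_mono upper) auto
        thus ?thesis using \<open>M \<ge> 2\<close> by simp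
      qed
      finally show ?thesis by (simp add: algebra_simps)
    qed
    have "0 < c1 / M" "c1 / M \<le> 1" using c1 \<open>M \<ge> 2\<close> by (auto simp: field_simps)
    thus "\<exists>\<rho> c. 0 \<le> \<rho> \<and> \<rho> < 1 \<and> 0 < c \<and>
      (\<forall>x s. (\<Sum>a\<in>V. x a) + (\<Sum>a\<in>V. s a) = 0 \<longrightarrow>
        (\<Sum>e\<in>E. pr e * lyapunov eps (gossip_step eps w e (x, s))) \<le> \<rho> * lyapunov eps (x, s)) \<and>
      (\<forall>x s. c * (energy x + (mass s)\<^sup>2) \<le> lyapunov eps (x, s))"
      using drift lower c by (intro exI[of _ "1 - c1 / M"] exI[of _ c]) auto
  qed
qed

end

section \<open>Consensus\<close>

context gossip_network begin

section \<open>From contraction to mean-square consensus\<close>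

text \<open>Only differences of x enter the increment. Shifting by the average makes the total of x
  and s vanish, since s starts at 0.\<close>

lemma gossip_run_shift:
  "gossip_run eps w es (\<lambda>l. x l - c, s) =
    (\<lambda>l. fst (gossip_run eps w es (x, s)) l - c, snd (gossip_run eps w es (x, s)))"
proof (induction es arbitrary: x s)
  case (Cons e es)
  have "gossip_step eps w e (\<lambda>l. x l - c, s) =
      (\<lambda>l. fst (gossip_step eps w e (x, s)) l - c, snd (gossip_step eps w e (x, s)))"
    by (auto simp: gossip_step_alt Let_def fun_eq_iff algebra_simps)
  thus ?case using Cons[of "fst (gossip_step eps w e (x, s))" "snd (gossip_step eps w e (x, s))"]
    by (simp add: gossip_run_def)
qed (simp add: gossip_run_def)

lemma expect_from_tendsto_0:
  assumes "I st" "\<And>e st. e \<in> E \<Longrightarrow> I st \<Longrightarrow> I (gossip_step eps w e st)" "0 \<le> \<rho>" "\<rho> < 1"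
    and drift: "\<And>st. I st \<Longrightarrow> (\<Sum>e\<in>E. pr e * W (gossip_step eps w e st)) \<le> \<rho> * W st"
    and f: "\<And>st. 0 \<le> f st" "\<And>st. f st \<le> B * W st" "B \<ge> 0"
  shows "(\<lambda>k. expect_from eps k f st) \<longlonglongrightarrow> 0"
proof (rule tendsto_sandwich)
  show "\<forall>\<^sub>F k in sequentially. 0 \<le> expect_from eps k f st"
    using expect_from_mono[of _ "\<lambda>_. 0" eps st f] f(1) by (simp add: expect_from_const)
  have "expect_from eps k f st \<le> B * W st * \<rho> ^ k" for k
  proof -
    have "expect_from eps k f st \<le> B * expect_from eps k W st"
      using expect_from_mono[of k f eps st "\<lambda>st. B * W st"] f(2) by (simp add: expect_from_cmult)
    also have "\<dots> \<le> B * (\<rho> ^ k * W st)"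
      using assms(1-3) drift f(3) by (intro mult_left_mono expect_from_geometric[where I = I]) auto
    finally show ?thesis by (simp add: mult_ac)
  qed
  thus "\<forall>\<^sub>F k in sequentially. expect_from eps k f st \<le> B * W st * \<rho> ^ k" by simp
  have "(\<lambda>k. B * W st * \<rho> ^ k) \<longlonglongrightarrow> B * W st * 0"
    using assms(3,4) by (intro tendsto_intros LIMSEQ_power_zero) auto
  thus "(\<lambda>k. B * W st * \<rho> ^ k) \<longlonglongrightarrow> 0" by simp
qed simp

lemma positive_lower_bound:
  fixes h :: "nat \<Rightarrow> real"
  assumes "\<And>a. a \<in> V \<Longrightarrow> h a > 0"
  obtains l where "l > 0" "\<And>a. a \<in> V \<Longrightarrow> l \<le> h a"
proof (rule that[of "Min (h ` V)"])
  show "Min (h ` V) > 0" using n_gt_1 assms by (subst Min_gr_iff) auto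
qed simp

lemma strongly_connected_imp_consensus:
  assumes sc: "strongly_connected n E"
  shows "\<exists>eb > 0. \<forall>eps. 0 < eps \<and> eps < eb \<longrightarrow> ms_average_consensus n E p w eps"
proof -
  obtain \<pi> where \<pi>: "\<And>i. i \<in> V \<Longrightarrow> \<pi> i > 0" "(\<Sum>i\<in>V. \<pi> i) = 1"
    "\<And>f. (\<Sum>e\<in>E. \<pi> (snd e) * (pr e * wt e) * (f (fst e) - f (snd e))) = 0"
    using stationary_vector[OF sc, of "\<lambda>e. pr e * wt e", OF mult_pos_pos[OF edge_facts(4,5)]] by blast
  have \<kappa>: "\<pi> (snd e) * pr e * wt e * (1 - wt e) > 0" if "e \<in> E" for e
    using edge_facts[OF that] \<pi>(1)[of "snd e"] by simp
  obtain C where C: "C \<ge> 0" "\<And>x a b. a \<in> V \<Longrightarrow> b \<in> V \<Longrightarrow> \<bar>x a - x b\<bar> \<le>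
      C * sqrt (\<Sum>e\<in>E. (\<pi> (snd e) * pr e * wt e * (1 - wt e)) * (x (fst e) - x (snd e))\<^sup>2)"
    using disagreement_bound[OF sc, of "\<lambda>e. \<pi> (snd e) * pr e * wt e * (1 - wt e)", OF \<kappa>] by blast
  have in_edge: "\<exists>e\<in>E. snd e = a" if a: "a \<in> V" for a
  proof -
    \<comment> \<open>Any node other than \<open>a\<close>, available by \<open>n > 1\<close>; the
      last edge of a path from it enters \<open>a\<close>.\<close>
    define b where "b = (if a = 1 then 2 else 1 :: nat)"
    have "(b, a) \<in> E\<^sup>*" "b \<noteq> a" using sc a n_gt_1 by (auto simp: strongly_connected_def b_def)
    thus ?thesis by (metis rtranclE snd_conv)
  qed
  have "(\<Sum>e\<in>E. if snd e = a then pr e * (\<pi> a * wt e) else 0) > 0" if a: "a \<in> V" for a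
  proof -
    have pos: "pr e * (\<pi> a * wt e) > 0" if "e \<in> E" for e
      using edge_facts[OF that] \<pi>(1)[OF a] by simp
    obtain e where e: "e \<in> E" "snd e = a" using in_edge[OF a] by blast
    show ?thesis
      by (rule sum_pos2[of E e]) (use e pos in \<open>auto simp: less_imp_le\<close>)
  qed
  then obtain l where l: "l > 0" "\<And>a. a \<in> V \<Longrightarrow> l \<le> (\<Sum>e\<in>E. if snd e = a then pr e * (\<pi> a * wt e) else 0)"
    using positive_lower_bound[of "\<lambda>a. \<Sum>e\<in>E. if snd e = a then pr e * (\<pi> a * wt e) else 0"] by blast
  obtain r where r: "r > 0" "\<And>a. a \<in> V \<Longrightarrow> r \<le> \<pi> a" using positive_lower_bound[of \<pi>] \<pi>(1) by blast
  \<comment> \<open>The order of choices matters: \<tau> depends on \<open>l\<close>, then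
    \<open>K\<close> on \<tau>, and the threshold for \<open>eps\<close> on all of them.\<close>
  define \<tau> where "\<tau> = l / (8 * (real n)\<^sup>2)"
  have "\<tau> > 0" using l(1) n_gt_1 by (simp add: \<tau>_def)
  obtain K where K: "K \<ge> 1" "\<And>a b. a \<in> V \<Longrightarrow> b \<in> V \<Longrightarrow> 1 - met K a b \<le> \<tau>"
    using met_uniformly_close_to_1[OF sc \<open>\<tau> > 0\<close>] by blast
  interpret L: gossip_lyapunov n E p w \<pi> C K \<tau> l
    by unfold_locales (use \<pi> C K l in \<open>blast+\<close>)
  obtain eb where eb: "eb > 0" and ly: "\<And>eps. 0 < eps \<Longrightarrow> eps < eb \<Longrightarrow> \<exists>\<rho> c. 0 \<le> \<rho> \<and> \<rho> < 1 \<and> 0 < c \<and>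
    (\<forall>x s. (\<Sum>a\<in>V. x a) + (\<Sum>a\<in>V. s a) = 0 \<longrightarrow>
      (\<Sum>e\<in>E. pr e * L.lyapunov eps (gossip_step eps w e (x, s))) \<le> \<rho> * L.lyapunov eps (x, s)) \<and>
    (\<forall>x s. c * (L.energy x + (L.mass s)\<^sup>2) \<le> L.lyapunov eps (x, s))"
    using L.exists_lyapunov_threshold[OF \<tau>_def] by blast
  show ?thesis
  proof (intro exI[of _ eb] conjI allI impI eb)
    fix eps assume eps: "0 < eps \<and> eps < eb"
    then obtain \<rho> c where \<rho>: "0 \<le> \<rho>" "\<rho> < 1" and c: "0 < c"
      and drift: "\<And>x s. (\<Sum>a\<in>V. x a) + (\<Sum>a\<in>V. s a) = 0 \<Longrightarrow>
        (\<Sum>e\<in>E. pr e * L.lyapunov eps (gossip_step eps w e (x, s))) \<le> \<rho> * L.lyapunov eps (x, s)"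
      and lower: "\<And>x s. c * (L.energy x + (L.mass s)\<^sup>2) \<le> L.lyapunov eps (x, s)"
      using ly by blast
    define I where "I st \<longleftrightarrow> (\<Sum>a\<in>V. fst st a) + (\<Sum>a\<in>V. snd st a) = (0::real)"
      for st :: "(nat \<Rightarrow> real) \<times> (nat \<Rightarrow> real)"
    have I: "I (gossip_step eps w e st)" if "e \<in> E" "I st" for e st
      using L.sum_conserved[OF that(1), of "fst st" "snd st"] that(2) by (simp add: I_def)
    have driftI: "(\<Sum>e\<in>E. pr e * L.lyapunov eps (gossip_step eps w e st)) \<le> \<rho> * L.lyapunov eps st" if "I st" for st
      using drift[of "fst st" "snd st"] that by (simp add: I_def)
    have energy: "r * (\<Sum>a\<in>V. (x a)\<^sup>2) \<le> L.energy x" for x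
      unfolding L.energy_def sum_distrib_left using r by (intro sum_mono mult_right_mono) auto
    have e0: "0 \<le> L.energy x" for x using L.mean_square_le_energy[of x] by (meson order_trans zero_le_power2)
    have bx: "(\<Sum>a\<in>V. (x a)\<^sup>2) \<le> 1 / (c * r) * L.lyapunov eps (x, s)" for x s
    proof -
      have "c * (r * (\<Sum>a\<in>V. (x a)\<^sup>2)) \<le> c * (L.energy x + (L.mass s)\<^sup>2)"
        using c energy[of x] by (intro mult_left_mono) (auto simp: add_increasing2)
      also note lower[of x s]
      finally show ?thesis using c r by (simp add: field_simps)
    qed
    have bs: "(\<Sum>a\<in>V. (s a)\<^sup>2) \<le> 1 / c * L.lyapunov eps (x, s)" for x s
    proof -
      have "(\<Sum>a\<in>V. (s a)\<^sup>2) \<le> (L.mass s)\<^sup>2" using merged_le[of 0 s] by (simp only: merged_0 L.mass_def)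
      hence "c * (\<Sum>a\<in>V. (s a)\<^sup>2) \<le> c * (L.energy x + (L.mass s)\<^sup>2)"
        using c e0[of x] by (intro mult_left_mono) auto
      also note lower[of x s]
      finally show ?thesis using c by (simp add: field_simps)
    qed
    show "ms_average_consensus n E p w eps"
      unfolding ms_average_consensus_def Let_def
    proof (intro allI)
      fix x0 :: "nat \<Rightarrow> real"
      define xa where "xa = (\<Sum>l\<in>V. x0 l) / real n"
      define st where "st = ((\<lambda>l. x0 l - xa), (\<lambda>_. 0 :: real) :: nat \<Rightarrow> real)"
      have "I st" using n_gt_1 by (simp add: I_def st_def sum_subtractf xa_def)
      have shift: "gossip_expect E p w eps x0 k (\<lambda>(x, s). F (\<lambda>l. x l - xa) s) =
          expect_from eps k (\<lambda>(x, s). F x s) st" for k F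
        unfolding gossip_expect_eq expect_from_def st_def gossip_run_shift by (simp add: case_prod_beta)
      have "(\<lambda>k. expect_from eps k (\<lambda>(x, s). \<Sum>l\<in>V. (x l)\<^sup>2) st) \<longlonglongrightarrow> 0"
        by (rule expect_from_tendsto_0[where I = I and W = "L.lyapunov eps" and \<rho> = \<rho> and B = "1 / (c * r)"])
           (use \<open>I st\<close> I \<rho> driftI c r bx in \<open>auto intro: sum_nonneg simp del: atLeastAtMost_iff\<close>)
      moreover have "(\<lambda>k. expect_from eps k (\<lambda>(x, s). \<Sum>l\<in>V. (s l)\<^sup>2) st) \<longlonglongrightarrow> 0"
        by (rule expect_from_tendsto_0[where I = I and W = "L.lyapunov eps" and \<rho> = \<rho> and B = "1 / c"])
           (use \<open>I st\<close> I \<rho> driftI c bs in \<open>auto intro: sum_nonneg\<close>)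
      ultimately show "(\<lambda>k. gossip_expect E p w eps x0 k
           (\<lambda>(x, s). \<Sum>l\<in>V. (x l - (\<Sum>l\<in>V. x0 l) / real n)\<^sup>2)) \<longlonglongrightarrow> 0 \<and>
         (\<lambda>k. gossip_expect E p w eps x0 k (\<lambda>(x, s). \<Sum>l\<in>V. (s l)\<^sup>2)) \<longlonglongrightarrow> 0"
        using shift[of _ "\<lambda>x s. \<Sum>l\<in>V. (x l)\<^sup>2"] shift[of _ "\<lambda>x s. \<Sum>l\<in>V. (s l)\<^sup>2"]
        unfolding xa_def by simp
    qed
  qed
qed

end

theorem theorem2:
  fixes n :: nat and E :: "(nat \<times> nat) set" and p w :: "nat \<Rightarrow> nat \<Rightarrow> real"
  assumes "n > 1"
    and "E \<subseteq> {1..n} \<times> {1..n}"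
    and "\<forall>(j, i)\<in>E. j \<noteq> i"
    and "\<forall>(j, i)\<in>E. 0 < p i j \<and> p i j < 1"
    and "(\<Sum>(j, i)\<in>E. p i j) = 1"
    and "\<forall>(j, i)\<in>E. 0 < w i j \<and> w i j < 1"
  shows "strongly_connected n E \<longleftrightarrow>
         (\<exists>eb > 0. \<forall>eps. 0 < eps \<and> eps < eb \<longrightarrow> ms_average_consensus n E p w eps)"
proof -
  interpret gossip_network n E p w using assms by unfold_locales
  show ?thesis
  proof
    assume "\<exists>eb > 0. \<forall>eps. 0 < eps \<and> eps < eb \<longrightarrow> ms_average_consensus n E p w eps"
    \<comment> \<open>Consensus for a single admissible parameter already forces strong
      connectivity.\<close>
    then obtain eb :: real where "eb > 0" "ms_average_consensus n E p w (eb / 2)" by auto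
    thus "strongly_connected n E" using consensus_imp_strongly_connected by blast
  qed (rule strongly_connected_imp_consensus)
qed

end
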